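(* Consider the DSCMD-N iteration described in the context, and suppose that the network, stochastic-subgradient, noise and mirror-map assumptions listed in the context hold. Let $\alpha_t=\frac1{\sqrt{t+1}}$ and $r_t=\frac1{t+1}$ for all $t\ge0$, and let $\hat x_i^T=\frac1T\sum_{t=1}^Tx_i^t$. Then, almost surely, for all $i\in\mathcal V$, $$\liminf_{T\to\infty}F(\hat x_i^T)=F(x^* ),\qquad \liminf_{T\to\infty}\mathrm{dist}(\hat x_i^T,\mathcal X^* )=0,$$ and $$\lim_{T\to\infty}\min_{1\le t\le T}F(x_i^t)=F(x^* ),\qquad \lim_{T\to\infty}\Big(\min_{1\le t\le T}\mathrm{dist}(x_i^t,\mathcal X^* )\Big)=0.$$
   Context: Problem. $\mathcal V=\{1,\dots,N\}$ is a set of agents; $\mathcal X\subseteq\mathbb R^n$ is nonempty, convex and compact; $f_i,\chi_i:\mathbb R^n\to\mathbb R$ ($i\in\mathcal V$) are convex, possibly nonsmooth; $F_i=f_i+\chi_i$, $F=\sum_{i=1}^N F_i$. The problem is to minimize $F$ over $\mathcal X$; $\mathcal X^*$ is the set of minimizers and $x^*\in\mathcal X^*$. $\|\cdot\|$ is the Euclidean norm, and $\mathrm{dist}(x,M)=\inf\{\|x-m\|:m\in M\}$ for a closed set $M$. Mirror map. $\Phi:\mathbb R^n\to\mathbb R$ is continuously differentiable and $\sigma_\Phi$-strongly convex ($\sigma_\Phi>0$): $\Phi(x)\ge\Phi(y)+\langle\nabla\Phi(y),x-y\rangle+\frac{\sigma_\Phi}{2}\|x-y\|^2$. Its Bregman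 divergence is $D_\Phi(x,y)=\Phi(x)-\Phi(y)-\langle\nabla\Phi(y),x-y\rangle$. DSCMD-N. Starting from deterministic $x_i^0\in\mathcal X$, with stepsizes $\alpha_t>0$ and noise magnitudes $r_t>0$, for $t=0,1,2,\dots$ and $i\in\mathcal V$: $$y_i^t=\sum_{j=1}^N[P^t]_{ij}(x_j^t+r_t\xi_{ij}^t),\qquad x_i^{t+1}=\arg\min_{x\in\mathcal X}\Big\{\langle\tilde g_i^t,x\rangle+\frac1{\alpha_t}D_\Phi(x,y_i^t)+\chi_i(x)\Big\}.$$ Here $P^t$ is an $N\times N$ weight matrix, $\xi_{ij}^t$ is a random vector in $\mathbb R^n$, and $\tilde g_i^t=\tilde g_i(y_i^t)$ is a stochastic subgradient of $f_i$ queried at $y_i^t$. $\mathcal F_t$ is the $\sigma$-algebra of the history up to time $t$ ($\mathcal F_{-1}$ trivial); all processes are adapted, the noises and stochastic subgradients of time $t$ being $\mathcal F_t$-measurable. Network assumption. Each $P^t$ is doubly stochastic with nonnegative entries; $E^t=\{(i,j):[P^t]_{ij}>0\}$; there is an integer $B\ge1$ such that the graph $(\mathcal V,\bigcup_{t=sB+1}^{(s+1)B}E^t)$ is strongly connected for every $s\ge0$; there is $\theta\in(0,1)$ with $[P^t]_{ii}\ge\theta$ for all $i,t$ and $[P^t]_{ij}\ge\theta$ whenever $(j,i)\in E^t$. Stochastic-subgradient assumption. There is $G_f\ge0$ such that at any $x\in\mathcal X$, $\mathbb E[\tilde g_i(x)\mid\mathcal F_{t-1}]=g_i(x)\in\partial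 f_i(x)$ and $\mathbb E[\|\tilde g_i(x)\|^2\mid\mathcal F_{t-1}]\le G_f^2$; the same holds at the query points: conditionally on $\mathcal F_{t-1}$ and the time-$t$ noises, $\tilde g_i^t$ has mean $g_i(y_i^t)\in\partial f_i(y_i^t)$ and second moment (of the norm) at most $G_f^2$. Noise assumption. At each time $t$, the noise on link $(i,j)$ is independent of the noise on link $(i',j')$ for $i\ne i'$, $j\neq j'$; and $\mathbb E[\|\xi_{ij}^t\|^2\mid\mathcal F_{t-1}]\le\nu$ for all $i,j\in\mathcal V$ and $t$. Mirror-map assumption. $\|\nabla\Phi(x)-\nabla\Phi(y)\|\le L_\Phi\|x-y\|$ for all $x,y\in\mathbb R^n$; and $D_\Phi(a,\sum_{i=1}^N\nu_ib_i)\le\sum_{i=1}^N\nu_iD_\Phi(a,b_i)$ for all $a,b_1,\dots,b_N\in\mathbb R^n$ and $\nu_i\in[0,1]$ with $\sum_i\nu_i=1$. *)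

theory Defs
  imports "HOL-Probability.Probability"
begin

text \<open>
  The agents are the elements of a finite type \<open>'v\<close>, so that \<open>N = CARD('v)\<close>; the ambient space
  is \<open>real ^ 'n\<close>. Processes take their arguments in the order agent(s), time, sample point;
  the weight matrix entry with indices \<open>i\<close>, \<open>j\<close> at time \<open>t\<close> is \<open>P t $ i $ j\<close>.
\<close>

definition subdifferential :: "(real ^ 'n \<Rightarrow> real) \<Rightarrow> real ^ 'n \<Rightarrow> (real ^ 'n) set" where
  "subdifferential f z = {g. \<forall>w. f w \<ge> f z + g \<bullet> (w - z)}"

definition total_objective ::
    "('v::finite \<Rightarrow> real ^ 'n \<Rightarrow> real) \<Rightarrow> ('v \<Rightarrow> real ^ 'n \<Rightarrow> real) \<Rightarrow> real ^ 'n \<Rightarrow> real" where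
  "total_objective f chi z = (\<Sum>i\<in>UNIV. f i z + chi i z)"

definition minimizers :: "(real ^ 'n \<Rightarrow> real) \<Rightarrow> (real ^ 'n) set \<Rightarrow> (real ^ 'n) set" where
  "minimizers F X = {z. is_arg_min F (\<lambda>z. z \<in> X) z}"

text \<open>Throughout, \<open>dPhi\<close> is the gradient of the mirror map \<open>Phi\<close>.\<close>

definition bregman ::
    "(real ^ 'n \<Rightarrow> real) \<Rightarrow> (real ^ 'n \<Rightarrow> real ^ 'n) \<Rightarrow> real ^ 'n \<Rightarrow> real ^ 'n \<Rightarrow> real" where
  "bregman Phi dPhi x y = Phi x - Phi y - dPhi y \<bullet> (x - y)"

definition mirror_map ::
    "(real ^ 'n \<Rightarrow> real) \<Rightarrow> (real ^ 'n \<Rightarrow> real ^ 'n) \<Rightarrow> real \<Rightarrow> bool" where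
  "mirror_map Phi dPhi \<sigma> \<longleftrightarrow>
     (\<forall>x. GDERIV Phi x :> dPhi x) \<and> continuous_on UNIV dPhi \<and> 0 < \<sigma> \<and>
     (\<forall>x y. Phi x \<ge> Phi y + dPhi y \<bullet> (x - y) + \<sigma> / 2 * (norm (x - y))\<^sup>2)"

text \<open>The convex combinations below have exactly one term per agent \<open>i :: 'v\<close>.\<close>

definition mirror_map_assumption ::
    "'v::finite itself \<Rightarrow> (real ^ 'n \<Rightarrow> real) \<Rightarrow> (real ^ 'n \<Rightarrow> real ^ 'n) \<Rightarrow> real \<Rightarrow> bool" where
  "mirror_map_assumption _ Phi dPhi L \<longleftrightarrow>
     (\<forall>x y. norm (dPhi x - dPhi y) \<le> L * norm (x - y)) \<and>
     (\<forall>a (b :: 'v \<Rightarrow> real ^ 'n) (w :: 'v \<Rightarrow> real).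
        (\<forall>i. w i \<in> {0..1}) \<and> (\<Sum>i\<in>UNIV. w i) = 1 \<longrightarrow>
        bregman Phi dPhi a (\<Sum>i\<in>UNIV. w i *\<^sub>R b i)
          \<le> (\<Sum>i\<in>UNIV. w i * bregman Phi dPhi a (b i)))"

definition doubly_stochastic :: "real ^ 'v ^ ('v::finite) \<Rightarrow> bool" where
  "doubly_stochastic A \<longleftrightarrow>
     (\<forall>i j. 0 \<le> A $ i $ j) \<and> (\<forall>i. (\<Sum>j\<in>UNIV. A $ i $ j) = 1) \<and> (\<forall>j. (\<Sum>i\<in>UNIV. A $ i $ j) = 1)"

definition edges :: "real ^ 'v ^ ('v::finite) \<Rightarrow> ('v \<times> 'v) set" where
  "edges A = {(i, j). A $ i $ j > 0}"

definition strongly_connected_edges :: "('v \<times> 'v) set \<Rightarrow> bool" where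
  "strongly_connected_edges E \<longleftrightarrow> (\<forall>i j. (i, j) \<in> E\<^sup>*)"

definition network_assumption :: "(nat \<Rightarrow> real ^ 'v ^ ('v::finite)) \<Rightarrow> nat \<Rightarrow> real \<Rightarrow> bool" where
  "network_assumption P B \<theta> \<longleftrightarrow>
     (\<forall>t. doubly_stochastic (P t)) \<and>
     B \<ge> 1 \<and>
     (\<forall>s. strongly_connected_edges (\<Union>t\<in>{s * B + 1..(s + 1) * B}. edges (P t))) \<and>
     0 < \<theta> \<and> \<theta> < 1 \<and>
     (\<forall>i t. P t $ i $ i \<ge> \<theta>) \<and>
     (\<forall>i j t. (j, i) \<in> edges (P t) \<longrightarrow> P t $ i $ j \<ge> \<theta>)"

text \<open>\<open>past M F t\<close> is the $\sigma$-algebra $\mathcal F_{t-1}$, where $\mathcal F_{-1}$ is trivial.\<close>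

definition past :: "'w measure \<Rightarrow> (nat \<Rightarrow> 'w measure) \<Rightarrow> nat \<Rightarrow> 'w measure" where
  "past M F t = (case t of 0 \<Rightarrow> sigma (space M) {} | Suc s \<Rightarrow> F s)"

text \<open>The $\sigma$-algebra generated by $\mathcal F_{t-1}$ and all noises of time \<open>t\<close>.\<close>

definition past_noise ::
    "'w measure \<Rightarrow> (nat \<Rightarrow> 'w measure) \<Rightarrow> ('v \<Rightarrow> 'v \<Rightarrow> nat \<Rightarrow> 'w \<Rightarrow> real ^ 'n) \<Rightarrow> nat \<Rightarrow> 'w measure" where
  "past_noise M F \<xi> t =
     sigma (space M)
       (sets (past M F t) \<union> (\<Union>i j. sets (vimage_algebra (space M) (\<xi> i j t) borel)))"

definition vec_cond_exp ::
    "'w measure \<Rightarrow> 'w measure \<Rightarrow> ('w \<Rightarrow> real ^ 'n) \<Rightarrow> 'w \<Rightarrow> real ^ 'n" where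
  "vec_cond_exp M H Z \<omega> = (\<chi> k. real_cond_exp M H (\<lambda>\<omega>. Z \<omega> $ k) \<omega>)"

text \<open>
  Conditional second moment as an extended nonnegative number: \<open>real_cond_exp\<close> would return \<open>0\<close>
  where the conditional expectation is infinite, so bounding it would not bound the moment.
\<close>

definition cond_second_moment ::
    "'w measure \<Rightarrow> 'w measure \<Rightarrow> ('w \<Rightarrow> real ^ 'n) \<Rightarrow> 'w \<Rightarrow> ennreal" where
  "cond_second_moment M H Z = nn_cond_exp M H (\<lambda>\<omega>. ennreal ((norm (Z \<omega>))\<^sup>2))"

definition noise_assumption ::
    "'w measure \<Rightarrow> (nat \<Rightarrow> 'w measure) \<Rightarrow> ('v \<Rightarrow> 'v \<Rightarrow> nat \<Rightarrow> 'w \<Rightarrow> real ^ 'n) \<Rightarrow> real \<Rightarrow> bool" where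
  "noise_assumption M F \<xi> \<nu> \<longleftrightarrow>
     0 \<le> \<nu> \<and>
     (\<forall>i j i' j' t. i \<noteq> i' \<and> j \<noteq> j' \<longrightarrow>
        prob_space.indep_var M borel (\<xi> i j t) borel (\<xi> i' j' t)) \<and>
     (\<forall>i j t. AE \<omega> in M. cond_second_moment M (past M F t) (\<xi> i j t) \<omega> \<le> ennreal \<nu>)"

text \<open>
  \<open>gt i t z \<omega>\<close> is the stochastic subgradient of \<open>f i\<close> that the oracle returns at time \<open>t\<close> when
  queried at the point \<open>z\<close>; \<open>g i z\<close> is the subgradient that it estimates.
\<close>

definition stochastic_subgradient_assumption ::
    "'w measure \<Rightarrow> (nat \<Rightarrow> 'w measure) \<Rightarrow> (real ^ 'n) set \<Rightarrow> ('v \<Rightarrow> real ^ 'n \<Rightarrow> real) \<Rightarrow>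
     ('v \<Rightarrow> 'v \<Rightarrow> nat \<Rightarrow> 'w \<Rightarrow> real ^ 'n) \<Rightarrow>
     ('v \<Rightarrow> real ^ 'n \<Rightarrow> real ^ 'n) \<Rightarrow> ('v \<Rightarrow> nat \<Rightarrow> real ^ 'n \<Rightarrow> 'w \<Rightarrow> real ^ 'n) \<Rightarrow>
     ('v \<Rightarrow> nat \<Rightarrow> 'w \<Rightarrow> real ^ 'n) \<Rightarrow> real \<Rightarrow> bool" where
  "stochastic_subgradient_assumption M F X f \<xi> g gt y G \<longleftrightarrow>
     0 \<le> G \<and>
     (\<forall>i t. \<forall>z\<in>X.
        g i z \<in> subdifferential (f i) z \<and>
        (AE \<omega> in M. vec_cond_exp M (past M F t) (gt i t z) \<omega> = g i z) \<and>
        (AE \<omega> in M. cond_second_moment M (past M F t) (gt i t z) \<omega> \<le> ennreal (G\<^sup>2))) \<and>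
     (\<forall>i t.
        (AE \<omega> in M. g i (y i t \<omega>) \<in> subdifferential (f i) (y i t \<omega>)) \<and>
        (AE \<omega> in M. vec_cond_exp M (past_noise M F \<xi> t) (\<lambda>\<omega>. gt i t (y i t \<omega>) \<omega>) \<omega>
                    = g i (y i t \<omega>)) \<and>
        (AE \<omega> in M. cond_second_moment M (past_noise M F \<xi> t) (\<lambda>\<omega>. gt i t (y i t \<omega>) \<omega>) \<omega>
                    \<le> ennreal (G\<^sup>2)))"

definition adapted_processes ::
    "'w measure \<Rightarrow> (nat \<Rightarrow> 'w measure) \<Rightarrow> (real ^ 'n) set \<Rightarrow>
     ('v \<Rightarrow> 'v \<Rightarrow> nat \<Rightarrow> 'w \<Rightarrow> real ^ 'n) \<Rightarrow> ('v \<Rightarrow> nat \<Rightarrow> real ^ 'n \<Rightarrow> 'w \<Rightarrow> real ^ 'n) \<Rightarrow>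
     ('v \<Rightarrow> nat \<Rightarrow> 'w \<Rightarrow> real ^ 'n) \<Rightarrow> ('v \<Rightarrow> nat \<Rightarrow> 'w \<Rightarrow> real ^ 'n) \<Rightarrow> bool" where
  "adapted_processes M F X \<xi> gt x y \<longleftrightarrow>
     filtration (space M) F \<and> (\<forall>t. subalgebra M (F t)) \<and>
     (\<forall>i j t. \<xi> i j t \<in> borel_measurable (F t)) \<and>
     (\<forall>i t. \<forall>z\<in>X. gt i t z \<in> borel_measurable (F t)) \<and>
     (\<forall>i t. (\<lambda>\<omega>. gt i t (y i t \<omega>) \<omega>) \<in> borel_measurable (F t)) \<and>
     (\<forall>i t. x i t \<in> borel_measurable (F t)) \<and>
     (\<forall>i t. y i t \<in> borel_measurable (F t))"

text \<open>
  For a strongly convex mirror map the minimizer in the mirror descent step is unique, so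
  \<open>is_arg_min\<close> determines \<open>x i (Suc t) \<omega>\<close>.
\<close>

definition dscmd_n ::
    "'w measure \<Rightarrow> (real ^ 'n) set \<Rightarrow> ('v::finite \<Rightarrow> real ^ 'n \<Rightarrow> real) \<Rightarrow>
     (real ^ 'n \<Rightarrow> real) \<Rightarrow> (real ^ 'n \<Rightarrow> real ^ 'n) \<Rightarrow> (nat \<Rightarrow> real ^ 'v ^ 'v) \<Rightarrow>
     (nat \<Rightarrow> real) \<Rightarrow> (nat \<Rightarrow> real) \<Rightarrow>
     ('v \<Rightarrow> 'v \<Rightarrow> nat \<Rightarrow> 'w \<Rightarrow> real ^ 'n) \<Rightarrow> ('v \<Rightarrow> nat \<Rightarrow> real ^ 'n \<Rightarrow> 'w \<Rightarrow> real ^ 'n) \<Rightarrow>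
     ('v \<Rightarrow> real ^ 'n) \<Rightarrow> ('v \<Rightarrow> nat \<Rightarrow> 'w \<Rightarrow> real ^ 'n) \<Rightarrow> ('v \<Rightarrow> nat \<Rightarrow> 'w \<Rightarrow> real ^ 'n) \<Rightarrow> bool" where
  "dscmd_n M X chi Phi dPhi P \<alpha> r \<xi> gt x0 x y \<longleftrightarrow>
     (\<forall>i. x0 i \<in> X) \<and>
     (\<forall>\<omega>\<in>space M. \<forall>i.
        x i 0 \<omega> = x0 i \<and>
        (\<forall>t. y i t \<omega> = (\<Sum>j\<in>UNIV. P t $ i $ j *\<^sub>R (x j t \<omega> + r t *\<^sub>R \<xi> i j t \<omega>)) \<and>
             is_arg_min
               (\<lambda>z. gt i t (y i t \<omega>) \<omega> \<bullet> z + 1 / \<alpha> t * bregman Phi dPhi z (y i t \<omega>) + chi i z)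
               (\<lambda>z. z \<in> X) (x i (Suc t) \<omega>)))"

definition average_iterate ::
    "('v \<Rightarrow> nat \<Rightarrow> 'w \<Rightarrow> real ^ 'n) \<Rightarrow> 'v \<Rightarrow> nat \<Rightarrow> 'w \<Rightarrow> real ^ 'n" where
  "average_iterate x i T \<omega> = (1 / real T) *\<^sub>R (\<Sum>t=1..T. x i t \<omega>)"

end

(*
  With z the noiseless average of its neighbours, each agent moves in one round to a point at distance
  O(alpha_t p_t) from z, where p_t collects the norms of the noises and stochastic subgradients
  of round t and E p_t^2 is bounded.  The energy sum_i |x_i|^2 drops in every round by a multiple of
  the squared disagreement along the active links, up to O(alpha_t p_t); since sum_{t<T} alpha_t is
  O(sqrt T), the mean disagreement along active links, and by connectivity within blocks of length B
  the mean disagreement of all agents, tends to 0 in L1.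
  The mirror descent inequality bounds F(x_k^t) - min F by (V_t - V_{t+1}) / alpha_t plus
  O(alpha_t p_t^2), the disagreement, and a term of mean zero, where V_t is the total Bregman
  divergence from a minimizer.  As V is bounded on the compact X, summation by parts gives
  E (1/T) sum_{t<=T} (F(x_k^t) - min F) -> 0.  Hence the Cesaro means of the gaps tend to 0 almost
  surely along a subsequence, which is all that convexity and compactness need for the four limits.
*)
theory Submission
  imports Defs "HOL-Real_Asymp.Real_Asymp"
begin

section \<open>Mirror steps\<close>

text \<open>Noise is added before the mirror step and is unbounded, so the query points leave
  \<open>X\<close>. Lipschitz bounds valid only on \<open>X\<close> therefore do not apply to them;
  the form used here is one-sided, with only the point of the first value in \<open>X\<close>. The
  noise is not assumed to have mean zero, so its effect on the divergence cannot cancel in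
  expectation and is paid for by size. The schedule makes this affordable: \<open>r t\<close> is the
  square of \<open>\<alpha> t\<close>, so after division by \<open>\<alpha> t\<close> the noise
  costs no more than the usual mirror descent error. Consensus is obtained without estimating
  products of weight matrices. The energy controls only squares of disagreements, whereas the
  objective sees first powers; a free threshold \<epsilon> links the two and is tuned to the horizon
  at the end. All inequalities for a run hold at a fixed sample point with constants independent of
  it. Probability enters through the second moment of the magnitudes, the zero mean of the
  fluctuations and the extraction of a subsequence.\<close>

lemma convex_on_UNIV_lipschitz_on_compact:
  fixes h :: "'a::euclidean_space \<Rightarrow> real"
  assumes "convex_on UNIV h" "compact X"
  shows "\<exists>K\<ge>0. \<forall>b\<in>X. \<forall>a. h b - h a \<le> K * norm (b - a)"
proof -
  have cont: "continuous_on UNIV h"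
    using assms(1) by (simp add: convex_on_continuous)
  define Y where "Y = {z + u | z u. z \<in> X \<and> u \<in> cball 0 (1::real)}"
  have "compact Y"
    unfolding Y_def using assms(2) compact_cball by (rule compact_sums)
  then have "bounded (h ` Y)"
    by (intro compact_imp_bounded compact_continuous_image continuous_on_subset[OF cont]) auto
  then obtain H where H: "H > 0" "\<And>z. z \<in> Y \<Longrightarrow> \<bar>h z\<bar> \<le> H"
    unfolding bounded_pos by auto
  have "h b - h a \<le> 2 * H * norm (b - a)" if b: "b \<in> X" for a b
  proof (cases "a = b")
    case False
    define d where "d = norm (b - a)"
    have d: "d > 0" using False by (simp add: d_def)
    \<comment> \<open>Prolong the segment from \<open>a\<close> through \<open>b\<close> by one
      unit. Wherever \<open>a\<close> lies, \<open>w\<close> stays in the compact set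
      \<open>Y\<close>, and by convexity the slope from \<open>a\<close> to \<open>b\<close> is at
      most the slope from \<open>b\<close> to \<open>w\<close>, hence at most
      \<open>2 * H\<close>.\<close>
    define w where "w = b + (1 / d) *\<^sub>R (b - a)"
    have wY: "w \<in> Y"
      unfolding Y_def w_def using b d by (fastforce simp: d_def)
    have bY: "b \<in> Y"
      unfolding Y_def using b by force
    define l where "l = d / (d + 1)"
    have l: "0 \<le> l" "l \<le> 1" "1 - l = 1 / (d + 1)"
      using d by (auto simp: l_def field_simps)
    have "(1 - l) *\<^sub>R a + l *\<^sub>R w = b"
    proof -
      have "l *\<^sub>R w = l *\<^sub>R b + (1 - l) *\<^sub>R (b - a)"
        using d by (simp add: w_def l(3) scaleR_right_distrib) (simp add: l_def)
      then show ?thesis by (simp add: algebra_simps)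
    qed
    then have "h b \<le> (1 - l) * h a + l * h w"
      using convex_onD[OF assms(1) l(1,2), of a w] by simp
    then have "(d + 1) * h b \<le> (d + 1) * ((1 - l) * h a + l * h w)"
      using d by (intro mult_left_mono) auto
    also have "\<dots> = ((d + 1) * (1 - l)) * h a + ((d + 1) * l) * h w"
      by (simp add: algebra_simps)
    also have "\<dots> = h a + d * h w"
    proof -
      have "(d + 1) * (1 - l) = 1" "(d + 1) * l = d"
        using d unfolding l(3) by (simp_all add: l_def)
      then show ?thesis by simp
    qed
    finally have "h b - h a \<le> d * (h w - h b)"
      by (simp add: algebra_simps)
    also have "\<dots> \<le> d * (2 * H)"
      using d H(2)[OF wY] H(2)[OF bY] by (intro mult_left_mono) auto
    finally show ?thesis by (simp add: d_def mult_ac)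
  qed simp
  then show ?thesis using H(1) by (intro exI[of _ "2 * H"]) auto
qed

locale smooth_mirror_map =
  fixes Phi :: "real ^ 'n \<Rightarrow> real" and dPhi :: "real ^ 'n \<Rightarrow> real ^ 'n" and \<sigma> L :: real
  assumes \<sigma>_pos: "0 < \<sigma>"
    and L_nonneg: "0 \<le> L"
    and Phi_continuous: "continuous_on UNIV Phi"
    and strong: "\<And>x y. Phi x \<ge> Phi y + dPhi y \<bullet> (x - y) + \<sigma> / 2 * (norm (x - y))\<^sup>2"
    and lipschitz: "\<And>x y. norm (dPhi x - dPhi y) \<le> L * norm (x - y)"
begin

abbreviation "D \<equiv> bregman Phi dPhi"

lemma Phi_ge: "Phi x \<ge> Phi y + dPhi y \<bullet> (x - y)"
proof -
  have "0 \<le> \<sigma> / 2 * (norm (x - y))\<^sup>2" using \<sigma>_pos by simp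
  then show ?thesis using strong[of y x] by linarith
qed

lemma inner_dPhi_le: "(dPhi x - dPhi y) \<bullet> v \<le> L * norm (x - y) * norm v"
  by (rule order_trans[OF norm_cauchy_schwarz mult_right_mono[OF lipschitz]]) simp

lemma bregman_nonneg: "0 \<le> D x y"
  using Phi_ge[of y x] by (simp add: bregman_def)

lemma bregman_le: "D x y \<le> L * (norm (x - y))\<^sup>2"
proof -
  have "D x y \<le> (dPhi x - dPhi y) \<bullet> (x - y)"
    using Phi_ge[of x y] by (simp add: bregman_def algebra_simps inner_diff_left inner_diff_right)
  also have "\<dots> \<le> L * norm (x - y) * norm (x - y)"
    by (rule inner_dPhi_le)
  finally show ?thesis by (simp add: power2_eq_square)
qed

lemma bregman_three_point:
  "(dPhi x - dPhi y) \<bullet> (z - x) = D z y - D z x - D x y"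
  by (simp add: bregman_def algebra_simps inner_diff_left inner_diff_right)

text \<open>Noise sits in the second argument of the divergence; the three-point identity moves its
  effect into gradient differences, which are Lipschitz. The term linear in \<open>e\<close> has to
  stay, since nothing makes it vanish on average.\<close>

lemma bregman_perturb: "D a (b + e) \<le> D a b + L * norm e * norm (a - b) + L * (norm e)\<^sup>2"
proof -
  have "D a (b + e) = D a b + D b (b + e) + (dPhi b - dPhi (b + e)) \<bullet> (a - b)"
    using bregman_three_point[of b "b + e" a] by simp
  moreover have "(dPhi b - dPhi (b + e)) \<bullet> (a - b) \<le> L * norm e * norm (a - b)"
    using inner_dPhi_le[of b "b + e" "a - b"] by simp
  moreover have "D b (b + e) \<le> L * (norm e)\<^sup>2"
    using bregman_le[of b "b + e"] by simp
  ultimately show ?thesis by linarith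
qed

lemma strong_monotone: "\<sigma> * (norm (x - y))\<^sup>2 \<le> (dPhi x - dPhi y) \<bullet> (x - y)"
  using strong[of y x] strong[of x y]
  by (simp add: norm_minus_commute inner_diff_left inner_diff_right algebra_simps)

section \<open>Minimizers of the mirror step: optimality, stability, measurability\<close>

definition mirror_step ::
    "(real ^ 'n) set \<Rightarrow> (real ^ 'n \<Rightarrow> real) \<Rightarrow> real \<Rightarrow> real ^ 'n \<Rightarrow> real ^ 'n \<Rightarrow> real ^ 'n \<Rightarrow> bool" where
  "mirror_step X h \<alpha> c y = is_arg_min (\<lambda>z. c \<bullet> z + 1 / \<alpha> * D z y + h z) (\<lambda>z. z \<in> X)"

lemma mirror_step_in: "mirror_step X h \<alpha> c y x \<Longrightarrow> x \<in> X"
  by (simp add: mirror_step_def is_arg_min_def)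

text \<open>First-order optimality with \<open>h\<close> entering through its values only, because
  it may be nonsmooth. The minimizer is compared with a point at parameter \<open>s\<close> on the
  segment towards \<open>z\<close>; after division by \<open>s\<close> the error
  \<open>s * M\<close> can be made as small as desired.\<close>

lemma mirror_step_variational:
  assumes step: "mirror_step X h \<alpha> c y x"
    and X: "convex X" and h: "convex_on UNIV h" and \<alpha>: "0 < \<alpha>" and z: "z \<in> X"
  shows "0 \<le> \<alpha> * (c \<bullet> (z - x) + h z - h x) + (dPhi x - dPhi y) \<bullet> (z - x)"
proof (rule field_le_epsilon)
  fix e :: real assume e: "0 < e"
  define M where "M = L * (norm (z - x))\<^sup>2"
  have M: "0 \<le> M" using L_nonneg by (simp add: M_def)
  \<comment> \<open>The denominator \<open>M + 1\<close> avoids division by zero, for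
    \<open>M\<close> vanishes when \<open>z = x\<close>.\<close>
  define s where "s = min 1 (e / (M + 1))"
  have s: "0 < s" "s \<le> 1" "s * M \<le> e"
  proof -
    show "0 < s" "s \<le> 1" using e M by (auto simp: s_def)
    have "s * M \<le> e / (M + 1) * (M + 1)"
      using e M by (intro mult_mono) (auto simp: s_def)
    then show "s * M \<le> e" using M by simp
  qed
  define w where "w = x + s *\<^sub>R (z - x)"
  have x: "x \<in> X" using step by (rule mirror_step_in)
  have w_eq: "w = (1 - s) *\<^sub>R x + s *\<^sub>R z" by (simp add: w_def algebra_simps)
  have "w \<in> X" unfolding w_eq using X x z s by (simp add: convexD_alt)
  then have "c \<bullet> x + 1 / \<alpha> * D x y + h x \<le> c \<bullet> w + 1 / \<alpha> * D w y + h w"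
    using step by (auto simp: mirror_step_def is_arg_min_def not_less)
  then have "\<alpha> * (c \<bullet> x + 1 / \<alpha> * D x y + h x) \<le> \<alpha> * (c \<bullet> w + 1 / \<alpha> * D w y + h w)"
    using \<alpha> by (intro mult_left_mono) auto
  then have 1: "0 \<le> \<alpha> * (c \<bullet> w - c \<bullet> x + h w - h x) + (D w y - D x y)"
    using \<alpha> by (simp add: algebra_simps)
  have "h w - h x \<le> s * (h z - h x)"
    using convex_onD[OF h, of s x z] s unfolding w_eq by (simp add: algebra_simps)
  then have "\<alpha> * (c \<bullet> w - c \<bullet> x + h w - h x) \<le> \<alpha> * (s * (c \<bullet> (z - x) + h z - h x))"
    using \<alpha> by (intro mult_left_mono) (auto simp: w_def inner_add_right algebra_simps)
  moreover have "D w y - D x y \<le> s * ((dPhi x - dPhi y) \<bullet> (z - x)) + s * (s * M)"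
  proof -
    \<comment> \<open>Taking the gradient at \<open>w\<close> rather than at \<open>x\<close> lets
      the remaining divergence enter with a favourable sign.\<close>
    have "D w y - D x y = - D x w + (dPhi w - dPhi y) \<bullet> (w - x)"
      by (simp add: bregman_def inner_diff_left inner_diff_right)
    also have "\<dots> \<le> (dPhi w - dPhi y) \<bullet> (w - x)"
      using bregman_nonneg by simp
    also have "\<dots> = (dPhi x - dPhi y) \<bullet> (w - x) + (dPhi w - dPhi x) \<bullet> (w - x)"
      by (simp add: inner_diff_left)
    also have "\<dots> \<le> (dPhi x - dPhi y) \<bullet> (w - x) + L * norm (w - x) * norm (w - x)"
      using inner_dPhi_le by simp
    also have "\<dots> = s * ((dPhi x - dPhi y) \<bullet> (z - x)) + s * (s * M)"
      using s by (simp add: w_def M_def power2_eq_square)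
    finally show ?thesis .
  qed
  ultimately have "0 \<le> s * (\<alpha> * (c \<bullet> (z - x) + h z - h x) + (dPhi x - dPhi y) \<bullet> (z - x) + s * M)"
    using 1 by (simp add: algebra_simps)
  then have "0 \<le> \<alpha> * (c \<bullet> (z - x) + h z - h x) + (dPhi x - dPhi y) \<bullet> (z - x) + s * M"
    using s by (simp add: zero_le_mult_iff)
  then show "0 \<le> \<alpha> * (c \<bullet> (z - x) + h z - h x) + (dPhi x - dPhi y) \<bullet> (z - x) + e"
    using s(3) by linarith
qed

lemma mirror_step_descent:
  assumes "mirror_step X h \<alpha> c y x" "convex X" "convex_on UNIV h" "0 < \<alpha>" "z \<in> X"
  shows "\<alpha> * (c \<bullet> (x - z) + h x - h z) \<le> D z y - D z x"
  using mirror_step_variational[OF assms] bregman_nonneg[of x y]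
  unfolding bregman_three_point by (simp add: inner_diff_right algebra_simps)

text \<open>Every term that bounds the squared distance contains one factor
  \<open>norm (x - z)\<close>, which cancels. The reference point is \<open>z\<close> and not
  \<open>y\<close>, because the variational inequality can be tested only at points of
  \<open>X\<close>; in a round \<open>z\<close> is the noiseless average.\<close>

lemma mirror_step_near:
  assumes step: "mirror_step X h \<alpha> c y x" "convex X" "convex_on UNIV h" "0 < \<alpha>" "z \<in> X"
    and K0: "0 \<le> K" and K: "\<And>a b. a \<in> X \<Longrightarrow> b \<in> X \<Longrightarrow> h a - h b \<le> K * norm (a - b)"
  shows "\<sigma> * norm (x - z) \<le> \<alpha> * (norm c + K) + L * norm (y - z)"
proof (cases "x = z")
  case True
  then show ?thesis using step(4) K0 L_nonneg by simp
next
  case False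
  have "\<sigma> * (norm (x - z))\<^sup>2 \<le> (dPhi x - dPhi z) \<bullet> (x - z)"
    by (rule strong_monotone)
  also have "\<dots> = (dPhi x - dPhi y) \<bullet> (x - z) + (dPhi y - dPhi z) \<bullet> (x - z)"
    by (simp add: inner_diff_left)
  also have "\<dots> \<le> \<alpha> * (c \<bullet> (z - x) + h z - h x) + L * norm (y - z) * norm (x - z)"
    using mirror_step_variational[OF step] inner_dPhi_le[of y z "x - z"]
    by (simp add: inner_diff_right algebra_simps)
  also have "\<dots> \<le> \<alpha> * ((norm c + K) * norm (x - z)) + L * norm (y - z) * norm (x - z)"
    using norm_cauchy_schwarz[of c "z - x"] K[OF step(5) mirror_step_in[OF step(1)]] step(4) L_nonneg
    by (intro add_mono mult_left_mono) (auto simp: norm_minus_commute algebra_simps)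
  finally have "(\<sigma> * norm (x - z)) * norm (x - z) \<le> (\<alpha> * (norm c + K) + L * norm (y - z)) * norm (x - z)"
    by (simp add: power2_eq_square algebra_simps)
  then show ?thesis using False by simp
qed

text \<open>Testing each variational inequality at the other minimizer and adding them cancels all
  values of \<open>h\<close>. Equal data give uniqueness of the minimizer; Lipschitz dependence on
  the data gives its measurability.\<close>

lemma mirror_step_stable:
  assumes X: "convex X" and h: "convex_on UNIV h" and \<alpha>: "0 < \<alpha>"
    and step: "mirror_step X h \<alpha> c y x" and step': "mirror_step X h \<alpha> c' y' x'"
  shows "\<sigma> * norm (x - x') \<le> \<alpha> * norm (c - c') + L * norm (y - y')"
proof (cases "x = x'")
  case False
  have "\<sigma> * (norm (x - x'))\<^sup>2 \<le> (dPhi x - dPhi x') \<bullet> (x - x')"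
    by (rule strong_monotone)
  also have "\<dots> \<le> \<alpha> * ((c - c') \<bullet> (x' - x)) + (dPhi y - dPhi y') \<bullet> (x - x')"
    using mirror_step_variational[OF step X h \<alpha> mirror_step_in[OF step']]
      mirror_step_variational[OF step' X h \<alpha> mirror_step_in[OF step]]
    by (simp add: inner_diff_left inner_diff_right algebra_simps)
  also have "\<dots> \<le> \<alpha> * (norm (c - c') * norm (x - x')) + L * norm (y - y') * norm (x - x')"
    using norm_cauchy_schwarz[of "c - c'" "x' - x"] inner_dPhi_le \<alpha>
    by (intro add_mono mult_left_mono) (auto simp: norm_minus_commute)
  finally have "(\<sigma> * norm (x - x')) * norm (x - x') \<le> (\<alpha> * norm (c - c') + L * norm (y - y')) * norm (x - x')"
    by (simp add: power2_eq_square algebra_simps)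
  then show ?thesis using False by simp
qed (use \<alpha> L_nonneg in simp)

lemma mirror_step_exists:
  assumes "compact X" "X \<noteq> {}" "convex_on UNIV h"
  shows "\<exists>x. mirror_step X h \<alpha> c y x"
proof -
  have h: "continuous_on UNIV h"
    using assms(3) by (simp add: convex_on_continuous)
  have "continuous_on X (\<lambda>z. c \<bullet> z + 1 / \<alpha> * D z y + h z)"
    unfolding bregman_def
    by (intro continuous_intros continuous_on_subset[OF Phi_continuous] continuous_on_subset[OF h]) auto
  from continuous_attains_inf[OF assms(1,2) this] show ?thesis
    by (auto simp: mirror_step_def is_arg_min_def not_less)
qed

lemma mirror_step_measurable:
  assumes X: "compact X" "X \<noteq> {}" "convex X" and h: "convex_on UNIV h" and \<alpha>: "0 < \<alpha>"
    and [measurable]: "c \<in> borel_measurable N" "y \<in> borel_measurable N"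
    and step: "\<And>\<omega>. \<omega> \<in> space N \<Longrightarrow> mirror_step X h \<alpha> (c \<omega>) (y \<omega>) (x \<omega>)"
  shows "x \<in> borel_measurable N"
proof -
  \<comment> \<open>An arbitrary selection of minimizers is Lipschitz by stability, hence Borel, and
    uniqueness identifies it with the given \<open>x\<close>.\<close>
  define s where "s = (\<lambda>(c, y). SOME x. mirror_step X h \<alpha> c y x)"
  have s: "mirror_step X h \<alpha> (fst p) (snd p) (s p)" for p
    unfolding s_def case_prod_beta by (rule someI_ex[OF mirror_step_exists[OF X(1,2) h]])
  have "((\<alpha> + L) / \<sigma>)-lipschitz_on UNIV s"
  proof (rule lipschitz_onI)
    fix p q :: "(real ^ 'n) \<times> (real ^ 'n)"
    have "\<sigma> * norm (s p - s q) \<le> \<alpha> * norm (fst p - fst q) + L * norm (snd p - snd q)"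
      by (rule mirror_step_stable[OF X(3) h \<alpha> s s])
    also have "\<dots> \<le> \<alpha> * norm (p - q) + L * norm (p - q)"
      using \<alpha> L_nonneg
      by (intro add_mono mult_left_mono)
        (auto simp: norm_prod_def simp flip: fst_diff snd_diff intro!: real_le_rsqrt)
    finally show "dist (s p) (s q) \<le> (\<alpha> + L) / \<sigma> * dist p q"
      using \<sigma>_pos by (simp add: dist_norm field_simps)
  qed (use \<alpha> L_nonneg \<sigma>_pos in simp)
  then have "continuous_on UNIV s" by (rule lipschitz_on_continuous_on)
  then have [measurable]: "s \<in> borel_measurable borel" by (rule borel_measurable_continuous_onI)
  have "x \<omega> = s (c \<omega>, y \<omega>)" if "\<omega> \<in> space N" for \<omega>
    using mirror_step_stable[OF X(3) h \<alpha> step[OF that], of "c \<omega>" "y \<omega>" "s (c \<omega>, y \<omega>)"] s[of "(c \<omega>, y \<omega>)"] \<sigma>_pos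
    by (simp add: mult_le_0_iff)
  moreover have "(\<lambda>\<omega>. s (c \<omega>, y \<omega>)) \<in> borel_measurable N" by measurable
  ultimately show ?thesis by (simp cong: measurable_cong)
qed

end

section \<open>Perturbed consensus\<close>

text \<open>The bracket on the right is the weighted variance \<open>V\<close>. As \<open>i\<close>
  itself has weight at least \<theta>, the mean is within squared distance
  \<open>V / \<theta>\<close> of \<open>z i\<close>. Passing through the mean doubles both
  contributions, and \<open>\<theta> \<le> 1\<close> merges them into the factor 4.\<close>

lemma weighted_variance_ge:
  fixes z :: "'v::finite \<Rightarrow> 'a::real_inner" and w :: "'v \<Rightarrow> real"
  assumes w: "\<And>j. 0 \<le> w j" "(\<Sum>j\<in>UNIV. w j) = 1" and \<theta>: "0 < \<theta>" "\<theta> \<le> w i"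
  shows "(\<Sum>l\<in>UNIV. w l * (norm (z i - z l))\<^sup>2)
    \<le> 4 / \<theta> * ((\<Sum>j\<in>UNIV. w j * (norm (z j))\<^sup>2) - (norm (\<Sum>j\<in>UNIV. w j *\<^sub>R z j))\<^sup>2)"
proof -
  define m where "m = (\<Sum>j\<in>UNIV. w j *\<^sub>R z j)"
  define V where "V = (\<Sum>j\<in>UNIV. w j * (norm (z j - m))\<^sup>2)"
  have "w i \<le> 1"
    using w member_le_sum[of i UNIV w] by simp
  then have \<theta>1: "\<theta> \<le> 1" using \<theta> by simp
  have "V = (\<Sum>j\<in>UNIV. w j * (norm (z j))\<^sup>2 - 2 * ((w j *\<^sub>R z j) \<bullet> m) + w j * (norm m)\<^sup>2)"
    unfolding V_def
    by (intro sum.cong refl)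
      (simp add: power2_norm_eq_inner inner_diff_left inner_diff_right inner_commute algebra_simps)
  also have "\<dots> = (\<Sum>j\<in>UNIV. w j * (norm (z j))\<^sup>2) - 2 * (m \<bullet> m) + (norm m)\<^sup>2"
    by (simp add: sum.distrib sum_subtractf w(2) m_def inner_sum_left
        flip: sum_distrib_left sum_distrib_right)
  finally have V: "V = (\<Sum>j\<in>UNIV. w j * (norm (z j))\<^sup>2) - (norm m)\<^sup>2"
    by (simp add: power2_norm_eq_inner)
  have "w i * (norm (z i - m))\<^sup>2 \<le> V"
    unfolding V_def using w(1) by (intro member_le_sum) auto
  moreover have "\<theta> * (norm (z i - m))\<^sup>2 \<le> w i * (norm (z i - m))\<^sup>2"
    using \<theta> by (intro mult_right_mono) auto
  ultimately have Vi: "(norm (z i - m))\<^sup>2 \<le> V / \<theta>"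
    using \<theta> by (simp add: field_simps)
  have V0: "0 \<le> V" unfolding V_def using w(1) by (intro sum_nonneg) auto
  have sq: "(norm (z i - z l))\<^sup>2 \<le> 2 * (norm (z i - m))\<^sup>2 + 2 * (norm (z l - m))\<^sup>2" for l
  proof -
    have "norm (z i - z l) \<le> norm (z i - m) + norm (z l - m)"
      using norm_triangle_ineq4[of "z i - m" "z l - m"] by simp
    then have "(norm (z i - z l))\<^sup>2 \<le> (norm (z i - m) + norm (z l - m))\<^sup>2"
      by (intro power_mono) auto
    also have "\<dots> \<le> 2 * (norm (z i - m))\<^sup>2 + 2 * (norm (z l - m))\<^sup>2"
      using sum_squares_bound[of "norm (z i - m)" "norm (z l - m)"] by (simp add: power2_sum)
    finally show ?thesis .
  qed
  have "(\<Sum>l\<in>UNIV. w l * (norm (z i - z l))\<^sup>2)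
      \<le> (\<Sum>l\<in>UNIV. w l * (2 * (norm (z i - m))\<^sup>2 + 2 * (norm (z l - m))\<^sup>2))"
    using w(1) sq by (intro sum_mono mult_left_mono) auto
  also have "\<dots> = 2 * (norm (z i - m))\<^sup>2 + 2 * V"
    by (simp add: V_def distrib_left sum.distrib sum_distrib_left w(2) mult_ac flip: sum_distrib_right)
  also have "\<dots> \<le> 2 * (V / \<theta>) + 2 * (V / \<theta>)"
    using Vi V0 \<theta> \<theta>1 by (intro add_mono mult_left_mono) (auto simp: field_simps mult_left_le)
  finally show ?thesis by (simp add: V m_def)
qed

locale perturbed_consensus =
  fixes P :: "nat \<Rightarrow> real ^ 'v ^ ('v::finite)" and B :: nat and \<theta> :: real
    and z :: "'v \<Rightarrow> nat \<Rightarrow> 'a::real_inner" and R :: real and e :: "nat \<Rightarrow> real"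
  assumes network: "network_assumption P B \<theta>"
    and z_le: "\<And>i t. norm (z i t) \<le> R"
    and perturb: "\<And>i t. norm (z i (Suc t) - (\<Sum>j\<in>UNIV. P t $ i $ j *\<^sub>R z j t)) \<le> e t"
begin


lemma \<theta>: "0 < \<theta>" "\<theta> < 1" and B: "1 \<le> B"
  using network by (auto simp: network_assumption_def)

lemma P_nonneg: "0 \<le> P t $ i $ j" and P_row: "(\<Sum>j\<in>UNIV. P t $ i $ j) = 1"
  and P_col: "(\<Sum>i\<in>UNIV. P t $ i $ j) = 1"
  using network by (auto simp: network_assumption_def doubly_stochastic_def)

lemma P_diag: "\<theta> \<le> P t $ i $ i" and P_edge: "(j, i) \<in> edges (P t) \<Longrightarrow> \<theta> \<le> P t $ i $ j"
  using network by (auto simp: network_assumption_def)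

lemma e_nonneg: "0 \<le> e t"
  using perturb[of undefined t] norm_ge_zero order_trans by blast

lemma R_nonneg: "0 \<le> R"
  using z_le[of undefined 0] norm_ge_zero order_trans by blast

definition spread :: "nat \<Rightarrow> real" where
  "spread t = (\<Sum>i\<in>UNIV. \<Sum>j\<in>UNIV. norm (z i t - z j t))"

definition link_spread :: "nat \<Rightarrow> real" where
  "link_spread t = (\<Sum>i\<in>UNIV. \<Sum>l\<in>UNIV. P t $ i $ l * norm (z i t - z l t))"

definition energy :: "nat \<Rightarrow> real" where
  "energy t = (\<Sum>i\<in>UNIV. (norm (z i t))\<^sup>2)"

lemma link_spread_nonneg: "0 \<le> link_spread t"
  unfolding link_spread_def by (intro sum_nonneg mult_nonneg_nonneg P_nonneg) auto

lemma norm_average_le: "norm (\<Sum>j\<in>UNIV. P t $ i $ j *\<^sub>R z j t) \<le> R"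
proof -
  have "norm (\<Sum>j\<in>UNIV. P t $ i $ j *\<^sub>R z j t) \<le> (\<Sum>j\<in>UNIV. P t $ i $ j * R)"
    by (intro sum_norm_le) (simp add: P_nonneg z_le mult_left_mono)
  then show ?thesis by (simp add: P_row flip: sum_distrib_right)
qed

text \<open>Convexity of the squared norm makes each row average lose exactly its weighted variance,
  and the unit column sums add the rows up to \<open>energy t\<close>. A perturbation of size
  \<open>e t\<close> changes a squared norm by at most \<open>2 * R * e t\<close>, both points
  having norm at most \<open>R\<close>.\<close>

lemma energy_decrease:
  "(\<Sum>i\<in>UNIV. \<Sum>l\<in>UNIV. P t $ i $ l * (norm (z i t - z l t))\<^sup>2)
     \<le> 4 / \<theta> * (energy t - energy (Suc t) + 2 * R * real CARD('v) * e t)"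
proof -
  define m where "m i = (\<Sum>j\<in>UNIV. P t $ i $ j *\<^sub>R z j t)" for i
  have m: "(norm (z i (Suc t)))\<^sup>2 - 2 * R * e t \<le> (norm (m i))\<^sup>2" for i
  proof -
    have "(norm (z i (Suc t)))\<^sup>2 - (norm (m i))\<^sup>2 = (z i (Suc t) - m i) \<bullet> (z i (Suc t) + m i)"
      by (simp add: power2_norm_eq_inner inner_diff_left inner_diff_right inner_add_left inner_add_right inner_commute)
    also have "\<dots> \<le> norm (z i (Suc t) - m i) * norm (z i (Suc t) + m i)"
      by (rule norm_cauchy_schwarz)
    also have "\<dots> \<le> e t * (R + R)"
      using perturb[of i t] norm_average_le[of t i] z_le[of i "Suc t"] e_nonneg[of t]
      by (intro mult_mono order_trans[OF norm_triangle_ineq] add_mono) (auto simp: m_def)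
    finally show ?thesis by (simp add: algebra_simps)
  qed
  have "(\<Sum>i\<in>UNIV. \<Sum>l\<in>UNIV. P t $ i $ l * (norm (z i t - z l t))\<^sup>2)
      \<le> (\<Sum>i\<in>UNIV. 4 / \<theta> * ((\<Sum>j\<in>UNIV. P t $ i $ j * (norm (z j t))\<^sup>2) - (norm (m i))\<^sup>2))"
    unfolding m_def
    by (intro sum_mono weighted_variance_ge P_nonneg P_row P_diag \<theta>)
  also have "\<dots> = 4 / \<theta> * ((\<Sum>i\<in>UNIV. \<Sum>j\<in>UNIV. P t $ i $ j * (norm (z j t))\<^sup>2) - (\<Sum>i\<in>UNIV. (norm (m i))\<^sup>2))"
    by (simp only: sum_subtractf flip: sum_distrib_left)
  also have "(\<Sum>i\<in>UNIV. \<Sum>j\<in>UNIV. P t $ i $ j * (norm (z j t))\<^sup>2) = energy t"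
    unfolding energy_def by (subst sum.swap) (simp add: P_col flip: sum_distrib_right)
  also have "4 / \<theta> * (energy t - (\<Sum>i\<in>UNIV. (norm (m i))\<^sup>2))
      \<le> 4 / \<theta> * (energy t - (\<Sum>i\<in>UNIV. (norm (z i (Suc t)))\<^sup>2 - 2 * R * e t))"
    using \<theta> by (intro mult_left_mono diff_left_mono sum_mono m) auto
  also have "\<dots> = 4 / \<theta> * (energy t - energy (Suc t) + 2 * R * real CARD('v) * e t)"
    by (simp add: energy_def sum_subtractf)
  finally show ?thesis .
qed

text \<open>Young's inequality turns first powers into squares at the price of \<epsilon> per row,
  and the energies telescope. The threshold is left free until the horizon is known.\<close>

lemma sum_link_spread_le:
  assumes \<epsilon>: "0 < \<epsilon>"
  shows "(\<Sum>t<T. link_spread t) \<le> real T * real CARD('v) * \<epsilon> + 4 / (\<theta> * \<epsilon>) * (real CARD('v) * R\<^sup>2 + 2 * R * real CARD('v) * (\<Sum>t<T. e t))"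
proof -
  have young: "a \<le> \<epsilon> + a\<^sup>2 / \<epsilon>" if "0 \<le> a" for a :: real
  proof (cases "a \<le> \<epsilon>")
    case True
    then show ?thesis using \<epsilon> by (simp add: add_increasing2)
  next
    case False
    then have "a * \<epsilon> \<le> a\<^sup>2" using that by (simp add: power2_eq_square mult_left_mono)
    then show ?thesis using \<epsilon> by (simp add: field_simps add_increasing)
  qed
  have "link_spread t \<le> real CARD('v) * \<epsilon> + 4 / (\<theta> * \<epsilon>) * (energy t - energy (Suc t) + 2 * R * real CARD('v) * e t)" for t
  proof -
    have "link_spread t \<le> (\<Sum>i\<in>UNIV. \<Sum>l\<in>UNIV. P t $ i $ l * (\<epsilon> + (norm (z i t - z l t))\<^sup>2 / \<epsilon>))"
      unfolding link_spread_def by (intro sum_mono mult_left_mono young P_nonneg) auto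
    also have "\<dots> = real CARD('v) * \<epsilon> + (\<Sum>i\<in>UNIV. \<Sum>l\<in>UNIV. P t $ i $ l * (norm (z i t - z l t))\<^sup>2) / \<epsilon>"
      by (simp add: distrib_left sum.distrib P_row flip: sum_distrib_right sum_divide_distrib)
    also have "\<dots> \<le> real CARD('v) * \<epsilon> + (4 / \<theta> * (energy t - energy (Suc t) + 2 * R * real CARD('v) * e t)) / \<epsilon>"
      using \<epsilon> by (intro add_left_mono divide_right_mono energy_decrease) auto
    finally show ?thesis by simp
  qed
  then have "(\<Sum>t<T. link_spread t)
      \<le> (\<Sum>t<T. real CARD('v) * \<epsilon> + 4 / (\<theta> * \<epsilon>) * (energy t - energy (Suc t) + 2 * R * real CARD('v) * e t))"
    by (intro sum_mono) auto
  also have "\<dots> = real T * real CARD('v) * \<epsilon> + 4 / (\<theta> * \<epsilon>) * (energy 0 - energy T + 2 * R * real CARD('v) * (\<Sum>t<T. e t))"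
    by (simp only: sum.distrib sum_lessThan_telescope' flip: sum_distrib_left) simp
  also have "\<dots> \<le> real T * real CARD('v) * \<epsilon> + 4 / (\<theta> * \<epsilon>) * (real CARD('v) * R\<^sup>2 + 2 * R * real CARD('v) * (\<Sum>t<T. e t))"
  proof -
    have "energy 0 \<le> real CARD('v) * R\<^sup>2"
      unfolding energy_def using sum_bounded_above[of UNIV "\<lambda>i. (norm (z i 0))\<^sup>2" "R\<^sup>2"] z_le
      by (simp add: power_mono)
    moreover have "0 \<le> energy T"
      unfolding energy_def by (intro sum_nonneg) auto
    ultimately show ?thesis
      using \<epsilon> \<theta> by (intro add_left_mono mult_left_mono) auto
  qed
  finally show ?thesis .
qed

lemma step_le: "norm (z i (Suc t) - z i t) \<le> link_spread t + e t"
proof -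
  have "(\<Sum>j\<in>UNIV. P t $ i $ j *\<^sub>R z j t) - z i t = (\<Sum>j\<in>UNIV. P t $ i $ j *\<^sub>R (z j t - z i t))"
    by (simp add: scaleR_diff_right sum_subtractf P_row flip: scaleR_left.sum)
  also have "norm \<dots> \<le> (\<Sum>l\<in>UNIV. P t $ i $ l * norm (z i t - z l t))"
    by (intro sum_norm_le) (simp add: P_nonneg norm_minus_commute)
  also have "\<dots> \<le> link_spread t"
    unfolding link_spread_def
    by (rule member_le_sum) (auto intro!: sum_nonneg mult_nonneg_nonneg P_nonneg)
  finally show ?thesis
    using norm_triangle_ineq[of "z i (Suc t) - (\<Sum>j\<in>UNIV. P t $ i $ j *\<^sub>R z j t)"
        "(\<Sum>j\<in>UNIV. P t $ i $ j *\<^sub>R z j t) - z i t"] perturb[of i t] by simp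
qed

text \<open>Mind the orientation: for a link \<open>(i, l)\<close> the network assumption bounds the
  transposed entry \<open>P t $ l $ i\<close> from below, so it is row \<open>l\<close> of
  \<open>link_spread\<close> that is used.\<close>

lemma edge_le:
  assumes "(i, l) \<in> edges (P t)"
  shows "norm (z i t - z l t) \<le> link_spread t / \<theta>"
proof -
  have "\<theta> * norm (z l t - z i t) \<le> P t $ l $ i * norm (z l t - z i t)"
    using P_edge[OF assms] by (intro mult_right_mono) auto
  also have "\<dots> \<le> (\<Sum>k\<in>UNIV. P t $ l $ k * norm (z l t - z k t))"
    by (rule member_le_sum) (auto intro!: mult_nonneg_nonneg P_nonneg)
  also have "\<dots> \<le> link_spread t"
    unfolding link_spread_def
    by (rule member_le_sum) (auto intro!: sum_nonneg mult_nonneg_nonneg P_nonneg)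
  finally show ?thesis using \<theta> by (simp add: field_simps norm_minus_commute)
qed

section \<open>Disagreement over blocks with a strongly connected union graph\<close>

definition block :: "nat \<Rightarrow> nat set" where
  "block s = {s * B + 1..(s + 1) * B}"

text \<open>One step moves an agent by at most \<open>link_spread t + e t\<close>, so the sum bounds
  every displacement inside the block; up to the factor \<theta> it also bounds every link active
  there.\<close>

definition block_budget :: "nat \<Rightarrow> real" where
  "block_budget s = (\<Sum>t\<in>block s. link_spread t + e t)"

lemma block_budget_nonneg: "0 \<le> block_budget s"
  unfolding block_budget_def by (intro sum_nonneg add_nonneg_nonneg link_spread_nonneg e_nonneg)

text \<open>
  Within a block no agent moves by more than the block budget, so the links active at different
  times of the block can be chained as if they were active simultaneously.
\<close>

lemma drift_le:
  assumes "t \<in> block s" "\<tau> \<in> block s"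
  shows "norm (z i t - z i \<tau>) \<le> block_budget s"
proof -
  have le: "norm (z i b - z i a) \<le> block_budget s" if "a \<le> b" "a \<in> block s" "b \<in> block s" for a b
  proof -
    have "norm (z i b - z i a) \<le> (\<Sum>t\<in>{a..<b}. norm (z i (Suc t) - z i t))"
      using that(1) norm_sum[of "\<lambda>t. z i (Suc t) - z i t" "{a..<b}"] by (simp add: sum_Suc_diff')
    also have "\<dots> \<le> (\<Sum>t\<in>{a..<b}. link_spread t + e t)"
      by (intro sum_mono step_le)
    also have "\<dots> \<le> block_budget s"
      unfolding block_budget_def using that
      by (intro sum_mono2) (auto simp: block_def link_spread_nonneg e_nonneg)
    finally show ?thesis .
  qed
  show ?thesis
    using le[of t \<tau>] le[of \<tau> t] assms by (cases t \<tau> rule: linorder_le_cases) (auto simp: norm_minus_commute)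
qed

text \<open>The factor 3 counts the drift of \<open>i\<close> to the time at which the link is
  active, the link itself, and the drift of \<open>l\<close> back; each costs at most
  \<open>block_budget s / \<theta>\<close>.\<close>

lemma block_edge_le:
  assumes t: "t \<in> block s" and il: "(i, l) \<in> (\<Union>t\<in>block s. edges (P t))"
  shows "norm (z i t - z l t) \<le> 3 / \<theta> * block_budget s"
proof -
  from il obtain \<tau> where \<tau>: "\<tau> \<in> block s" "(i, l) \<in> edges (P \<tau>)" by auto
  have "link_spread \<tau> \<le> link_spread \<tau> + e \<tau>" using e_nonneg by simp
  also have "\<dots> \<le> block_budget s"
    unfolding block_budget_def using \<tau>(1)
    by (intro member_le_sum) (auto simp: block_def link_spread_nonneg e_nonneg)
  finally have "link_spread \<tau> / \<theta> \<le> block_budget s / \<theta>"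
    using \<theta> by (simp add: divide_right_mono)
  moreover have "block_budget s \<le> block_budget s / \<theta>"
    using block_budget_nonneg[of s] \<theta> by (simp add: field_simps mult_left_le_one_le)
  moreover have "norm (z i t - z l t) \<le> norm (z i t - z i \<tau>) + norm (z i \<tau> - z l \<tau>) + norm (z l \<tau> - z l t)"
    by norm
  ultimately show ?thesis
    using drift_le[OF t \<tau>(1), of i] drift_le[OF \<tau>(1) t, of l] edge_le[OF \<tau>(2)] by simp
qed

text \<open>The exponent 4 splits evenly: there are \<open>CARD('v)\<close> squared ordered pairs,
  and each is joined by a path of at most \<open>card E\<close> links, a number that is again at
  most \<open>CARD('v)\<close> squared.\<close>

lemma block_spread_le:
  assumes t: "t \<in> block s"
  shows "spread t \<le> real CARD('v) ^ 4 * (3 / \<theta>) * block_budget s"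
proof -
  define E where "E = (\<Union>t\<in>block s. edges (P t))"
  define c where "c = 3 / \<theta> * block_budget s"
  have c: "0 \<le> c" unfolding c_def using \<theta> block_budget_nonneg by simp
  have path: "norm (z i t - z j t) \<le> real n * c" if "(i, j) \<in> E ^^ n" for i j n
    using that
  proof (induction n arbitrary: j)
    case (Suc n)
    then obtain k where k: "(i, k) \<in> E ^^ n" "(k, j) \<in> E" by auto
    have "norm (z i t - z j t) \<le> norm (z i t - z k t) + norm (z k t - z j t)"
      by norm
    then show ?case
      using Suc.IH[OF k(1)] block_edge_le[OF t k(2)[unfolded E_def], folded c_def]
      by (simp add: distrib_right)
  qed simp
  have "norm (z i t - z j t) \<le> (real CARD('v))\<^sup>2 * c" for i j
  proof -
    have "(i, j) \<in> E\<^sup>*"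
      using network by (auto simp: network_assumption_def strongly_connected_edges_def E_def block_def)
    then obtain n where n: "n \<le> card E" "(i, j) \<in> E ^^ n"
      using rtrancl_finite_eq_relpow[of E] by auto
    have "card E \<le> card (UNIV :: ('v \<times> 'v) set)"
      by (intro card_mono) auto
    also have "\<dots> = CARD('v)\<^sup>2"
      by (simp add: power2_eq_square)
    finally have "real n \<le> (real CARD('v))\<^sup>2"
      using n(1) by (metis le_trans of_nat_le_iff of_nat_power)
    then show ?thesis
      using path[OF n(2)] mult_right_mono[OF _ c] order_trans by blast
  qed
  then have "spread t \<le> (\<Sum>i\<in>(UNIV::'v set). \<Sum>j\<in>(UNIV::'v set). (real CARD('v))\<^sup>2 * c)"
    unfolding spread_def by (intro sum_mono)
  then show ?thesis by (simp add: c_def power2_eq_square eval_nat_numeral mult_ac)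
qed

text \<open>Blocks start at time 1, and completing the last one overshoots \<open>T\<close> by at
  most \<open>B\<close>. Writing the range as an initial segment of the naturals adds time 0, hence
  the bound \<open>T + B + 1\<close>.\<close>

lemma sum_spread_le:
  "(\<Sum>t=1..T. spread t) \<le> real B * real CARD('v) ^ 4 * (3 / \<theta>) * (\<Sum>t<T + B + 1. link_spread t + e t)"
proof -
  define k where "k = T div B + 1"
  have kB: "T \<le> k * B" "k * B \<le> T + B"
    using B by (auto simp: k_def dividend_less_div_times less_imp_le)
  have block: "sum h (block s) = (\<Sum>t\<in>{s * B..<s * B + B}. h (Suc t))" for h :: "nat \<Rightarrow> real" and s
    unfolding block_def
    by (rule sum.reindex_bij_witness[of _ Suc "\<lambda>t. t - 1"]) auto
  have blocks: "(\<Sum>s<k. sum h (block s)) = (\<Sum>t<k * B. h (Suc t))" for h :: "nat \<Rightarrow> real"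
    unfolding block by (rule sum.nat_group)
  have "(\<Sum>t=1..T. spread t) = (\<Sum>t<T. spread (Suc t))"
    by (simp add: sum.atLeast1_atMost_eq)
  also have "\<dots> \<le> (\<Sum>t<k * B. spread (Suc t))"
    using kB by (intro sum_mono2) (auto simp: spread_def intro!: sum_nonneg)
  also have "\<dots> = (\<Sum>s<k. sum spread (block s))"
    by (rule blocks[symmetric])
  also have "\<dots> \<le> (\<Sum>s<k. real B * (real CARD('v) ^ 4 * (3 / \<theta>) * block_budget s))"
  proof (intro sum_mono)
    fix s
    show "sum spread (block s) \<le> real B * (real CARD('v) ^ 4 * (3 / \<theta>) * block_budget s)"
      using sum_bounded_above[of "block s" spread, OF block_spread_le] by (simp add: block_def)
  qed
  also have "\<dots> = real B * real CARD('v) ^ 4 * (3 / \<theta>) * (\<Sum>s<k. block_budget s)"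
    by (simp only: sum_distrib_left mult.assoc)
  also have "\<dots> = real B * real CARD('v) ^ 4 * (3 / \<theta>) * (\<Sum>t<k * B. link_spread (Suc t) + e (Suc t))"
    unfolding block_budget_def by (subst blocks) simp
  also have "\<dots> \<le> real B * real CARD('v) ^ 4 * (3 / \<theta>) * (\<Sum>t<T + B. link_spread (Suc t) + e (Suc t))"
    using kB \<theta>
    by (intro mult_left_mono sum_mono2) (auto simp: link_spread_nonneg e_nonneg)
  also have "\<dots> \<le> real B * real CARD('v) ^ 4 * (3 / \<theta>) * (\<Sum>t<T + B + 1. link_spread t + e t)"
    using \<theta> unfolding Suc_eq_plus1[symmetric] sum.lessThan_Suc_shift
    by (intro mult_left_mono) (auto simp: link_spread_nonneg e_nonneg)
  finally show ?thesis .
qed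

end

section \<open>One round of mirror descent\<close>

text \<open>The summand 1 makes a magnitude at most its own square, so first-order errors can be
  absorbed into second-order ones, whose expectation the moment assumptions control.\<close>

definition magnitude ::
    "('v::finite \<Rightarrow> 'a::real_normed_vector) \<Rightarrow> ('v \<Rightarrow> 'v \<Rightarrow> 'a) \<Rightarrow> real" where
  "magnitude c \<zeta> = 1 + (\<Sum>i\<in>UNIV. norm (c i)) + (\<Sum>i\<in>UNIV. \<Sum>j\<in>UNIV. norm (\<zeta> i j))"

lemma magnitude_ge_1: "1 \<le> magnitude c \<zeta>"
  and norm_le_magnitude: "norm (c i) \<le> magnitude c \<zeta>"
  and norm_noise_le_magnitude: "norm (\<zeta> i j) \<le> magnitude c \<zeta>"
proof -
  have c: "norm (c i) \<le> (\<Sum>i\<in>UNIV. norm (c i))" for i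
    by (rule member_le_sum) auto
  have "norm (\<zeta> i j) \<le> (\<Sum>j\<in>UNIV. norm (\<zeta> i j))" for i j
    by (rule member_le_sum) auto
  moreover have "(\<Sum>j\<in>UNIV. norm (\<zeta> i j)) \<le> (\<Sum>i\<in>UNIV. \<Sum>j\<in>UNIV. norm (\<zeta> i j))" for i
    by (rule member_le_sum) (auto intro: sum_nonneg)
  ultimately have \<zeta>: "norm (\<zeta> i j) \<le> (\<Sum>i\<in>UNIV. \<Sum>j\<in>UNIV. norm (\<zeta> i j))" for i j
    using order_trans by blast
  have all: "1 + norm (c i) + norm (\<zeta> i j) \<le> magnitude c \<zeta>"
    using c \<zeta> by (simp add: magnitude_def add_mono)
  show "1 \<le> magnitude c \<zeta>" "norm (c i) \<le> magnitude c \<zeta>" "norm (\<zeta> i j) \<le> magnitude c \<zeta>"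
    using all norm_ge_zero[of "c i"] norm_ge_zero[of "\<zeta> i j"] by linarith+
qed

text \<open>The factor of \<open>a * p\<close> that \<open>mirror_step_near\<close> yields:
  \<open>1 + K\<close> from the subgradient and \<open>chi\<close>, \<open>L\<close> from the
  displacement by noise. Standing outside the locale of a round, the constant visibly does not
  depend on the sample point.\<close>

definition step_const :: "real \<Rightarrow> real \<Rightarrow> real \<Rightarrow> real" where
  "step_const \<sigma> L K = (1 + K + L) / \<sigma>"

text \<open>Collects the error \<open>C2\<close> of the mirror step and the cost
  \<open>N * K * (1 + C1)\<close> of moving function values to a common point.\<close>

definition descent_const :: "nat \<Rightarrow> real \<Rightarrow> real \<Rightarrow> real \<Rightarrow> real \<Rightarrow> real" where
  "descent_const N \<sigma> L K R = real N * ((1 + K) * (1 + step_const \<sigma> L K) + L * (2 * R + 1))"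

text \<open>One round at a fixed sample point: \<open>u\<close> and \<open>v\<close> are the old and
  new iterates, \<open>c\<close> the oracle answers, \<open>\<zeta>\<close> the noises,
  \<open>a\<close> and \<open>r\<close> the stepsize and noise magnitude. No probability is
  involved.\<close>

locale mirror_round = smooth_mirror_map Phi dPhi \<sigma> L
  for Phi :: "real ^ 'n \<Rightarrow> real" and dPhi :: "real ^ 'n \<Rightarrow> real ^ 'n" and \<sigma> L :: real +
  fixes f chi :: "'v::finite \<Rightarrow> real ^ 'n \<Rightarrow> real" and A :: "real ^ 'v ^ 'v" and X :: "(real ^ 'n) set"
    and u v y c :: "'v \<Rightarrow> real ^ 'n" and \<zeta> :: "'v \<Rightarrow> 'v \<Rightarrow> real ^ 'n" and a r K R :: real and xs :: "real ^ 'n"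
  assumes X: "convex X" and R: "\<And>z. z \<in> X \<Longrightarrow> norm z \<le> R" and xs: "xs \<in> X"
    and u: "\<And>i. u i \<in> X"
    and chi: "\<And>i. convex_on UNIV (chi i)"
    and K0: "0 \<le> K"
    and K: "\<And>i b a. b \<in> X \<Longrightarrow> f i b - f i a \<le> K * norm (b - a)"
      "\<And>i b a. b \<in> X \<Longrightarrow> chi i b - chi i a \<le> K * norm (b - a)"
    and A: "doubly_stochastic A"
    and a: "0 < a" "a \<le> 1" and r: "0 \<le> r" "r \<le> a\<^sup>2"
    and y: "\<And>i. y i = (\<Sum>j\<in>UNIV. A $ i $ j *\<^sub>R (u j + r *\<^sub>R \<zeta> i j))"
    and step: "\<And>i. mirror_step X (chi i) a (c i) (y i) (v i)"
    and jensen: "\<And>z (b :: 'v \<Rightarrow> real ^ 'n) w. (\<And>i. w i \<in> {0..1}) \<Longrightarrow> (\<Sum>i\<in>UNIV. w i) = 1 \<Longrightarrow>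
        D z (\<Sum>i\<in>UNIV. w i *\<^sub>R b i) \<le> (\<Sum>i\<in>UNIV. w i * D z (b i))"
begin

abbreviation "p \<equiv> magnitude c \<zeta>"

definition avg :: "'v \<Rightarrow> real ^ 'n" where
  "avg i = (\<Sum>j\<in>UNIV. A $ i $ j *\<^sub>R u j)"

lemma A_nonneg: "0 \<le> A $ i $ j" and A_row: "(\<Sum>j\<in>UNIV. A $ i $ j) = 1"
  and A_col: "(\<Sum>i\<in>UNIV. A $ i $ j) = 1"
  using A by (auto simp: doubly_stochastic_def)

lemma A_le_1: "A $ i $ j \<le> 1"
  using member_le_sum[of j UNIV "\<lambda>j. A $ i $ j"] by (simp add: A_nonneg A_row)

lemma avg_in: "avg i \<in> X"
  unfolding avg_def using X by (intro convex_sum) (auto simp: A_row A_nonneg u)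

lemma r_le: "r \<le> a"
  using r a power_decreasing[of 1 2 a] by simp

lemma p_le_square: "p \<le> p\<^sup>2"
  using magnitude_ge_1[of c \<zeta>] self_le_power[of p 2] by simp

lemma weighted_noise_le: "(\<Sum>j\<in>UNIV. A $ i $ j * norm (\<zeta> i j)) \<le> p"
proof -
  have "(\<Sum>j\<in>UNIV. A $ i $ j * norm (\<zeta> i j)) \<le> (\<Sum>j\<in>UNIV. A $ i $ j * p)"
    by (intro sum_mono mult_left_mono norm_noise_le_magnitude A_nonneg)
  then show ?thesis by (simp add: A_row flip: sum_distrib_right)
qed

lemma norm_y_avg: "norm (y i - avg i) \<le> r * p"
proof -
  have "y i - avg i = (\<Sum>j\<in>UNIV. A $ i $ j *\<^sub>R r *\<^sub>R \<zeta> i j)"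
    by (simp add: y avg_def scaleR_right_distrib sum.distrib)
  also have "norm \<dots> \<le> (\<Sum>j\<in>UNIV. r * (A $ i $ j * norm (\<zeta> i j)))"
    using r(1) by (intro sum_norm_le) (simp add: A_nonneg)
  also have "\<dots> \<le> r * p"
    using weighted_noise_le r(1) by (simp add: mult_left_mono flip: sum_distrib_left)
  finally show ?thesis .
qed

abbreviation "C1 \<equiv> step_const \<sigma> L K"

lemma C1_nonneg: "0 \<le> C1"
  unfolding step_const_def using K0 L_nonneg \<sigma>_pos by simp

lemma consensus_error: "norm (v i - avg i) \<le> C1 * a * p"
proof -
  have "\<sigma> * norm (v i - avg i) \<le> a * (norm (c i) + K) + L * norm (y i - avg i)"
    by (rule mirror_step_near[OF step X chi a(1) avg_in K0 K(2)])
  also have "\<dots> \<le> a * (p + K * p) + L * (a * p)"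
    using norm_le_magnitude[of c i \<zeta>] mult_left_mono[OF magnitude_ge_1[of c \<zeta>] K0] a(1) L_nonneg
      order_trans[OF norm_y_avg mult_right_mono[OF r_le]] magnitude_ge_1[of c \<zeta>]
    by (intro add_mono mult_left_mono) auto
  also have "\<dots> = (1 + K + L) * a * p"
    by (simp add: algebra_simps)
  finally show ?thesis
    using \<sigma>_pos by (simp add: step_const_def field_simps)
qed

text \<open>Jensen's inequality in the second argument distributes the divergence over the
  neighbours, and unit column sums remove the weights once the sums are exchanged: mixing alone does
  not increase the total divergence. The quadratic noise term is absorbed by
  \<open>r * r \<le> r\<close>.\<close>

lemma bregman_y_sum:
  "(\<Sum>i\<in>UNIV. D xs (y i)) \<le> (\<Sum>i\<in>UNIV. D xs (u i)) + real CARD('v) * (L * (2 * R + 1)) * r * p\<^sup>2"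
proof -
  have perturbed: "D xs (u j + r *\<^sub>R \<zeta> i j) \<le> D xs (u j) + L * (2 * R + 1) * r * p\<^sup>2" for i j
  proof -
    have "norm (xs - u j) \<le> 2 * R"
      using norm_triangle_ineq4[of xs "u j"] R[OF xs] R[OF u[of j]] by simp
    then have "L * norm (r *\<^sub>R \<zeta> i j) * norm (xs - u j) \<le> L * (r * p\<^sup>2) * (2 * R)"
      using L_nonneg r(1) norm_noise_le_magnitude[of \<zeta> i j c] p_le_square
      by (intro mult_mono) (auto simp: mult_left_mono)
    moreover have "L * (norm (r *\<^sub>R \<zeta> i j))\<^sup>2 \<le> L * (r * p\<^sup>2)"
    proof -
      have "r\<^sup>2 \<le> r" using r a r_le by (simp add: power2_eq_square mult_left_le)
      then have "r\<^sup>2 * (norm (\<zeta> i j))\<^sup>2 \<le> r * p\<^sup>2"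
        using norm_noise_le_magnitude[of \<zeta> i j c] r by (intro mult_mono power_mono) auto
      then show ?thesis using L_nonneg by (simp add: power_mult_distrib mult_left_mono)
    qed
    ultimately show ?thesis
      using bregman_perturb[of xs "u j" "r *\<^sub>R \<zeta> i j"] by (simp add: algebra_simps)
  qed
  have "(\<Sum>i\<in>UNIV. D xs (y i)) \<le> (\<Sum>i\<in>UNIV. \<Sum>j\<in>UNIV. A $ i $ j * (D xs (u j) + L * (2 * R + 1) * r * p\<^sup>2))"
  proof (rule sum_mono)
    fix i
    have "D xs (y i) \<le> (\<Sum>j\<in>UNIV. A $ i $ j * D xs (u j + r *\<^sub>R \<zeta> i j))"
      unfolding y by (rule jensen) (auto simp: A_nonneg A_le_1 A_row)
    also have "\<dots> \<le> (\<Sum>j\<in>UNIV. A $ i $ j * (D xs (u j) + L * (2 * R + 1) * r * p\<^sup>2))"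
      by (intro sum_mono mult_left_mono perturbed A_nonneg)
    finally show "D xs (y i) \<le> \<dots>" .
  qed
  also have "\<dots> = (\<Sum>j\<in>UNIV. (\<Sum>i\<in>UNIV. A $ i $ j) * (D xs (u j) + L * (2 * R + 1) * r * p\<^sup>2))"
    unfolding sum_distrib_right by (rule sum.swap)
  also have "\<dots> = (\<Sum>i\<in>UNIV. D xs (u i)) + real CARD('v) * (L * (2 * R + 1)) * r * p\<^sup>2"
    by (simp add: A_col sum.distrib)
  finally show ?thesis .
qed

definition C2 :: real where
  "C2 = real CARD('v) * (1 + C1) + real CARD('v) * (L * (2 * R + 1))"

text \<open>The mirror step controls the linear term at the new point \<open>v i\<close>. It is
  moved to \<open>y i\<close>, where the conditional mean of the oracle answer will be a
  subgradient. The move costs order \<open>a * p\<^sup>2\<close>, and so does the noise, because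
  \<open>r / a \<le> a\<close>.\<close>

lemma descent_at_query:
  "(\<Sum>i\<in>UNIV. c i \<bullet> (y i - xs) + chi i (v i) - chi i xs)
     \<le> 1 / a * ((\<Sum>i\<in>UNIV. D xs (u i)) - (\<Sum>i\<in>UNIV. D xs (v i))) + C2 * a * p\<^sup>2"
proof -
  have R0: "0 \<le> R" using R[OF xs] norm_ge_zero order_trans by blast
  have "c i \<bullet> (y i - xs) + chi i (v i) - chi i xs
      \<le> 1 / a * (D xs (y i) - D xs (v i)) + (1 + C1) * a * p\<^sup>2" for i
  proof -
    have "a * (c i \<bullet> (v i - xs) + chi i (v i) - chi i xs) \<le> D xs (y i) - D xs (v i)"
      by (rule mirror_step_descent[OF step X chi a(1) xs])
    then have "c i \<bullet> (v i - xs) + chi i (v i) - chi i xs \<le> 1 / a * (D xs (y i) - D xs (v i))"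
      using a(1) by (simp add: field_simps)
    moreover have "c i \<bullet> (y i - v i) \<le> (1 + C1) * a * p\<^sup>2"
    proof -
      have "norm (y i - v i) \<le> norm (y i - avg i) + norm (v i - avg i)"
        by norm
      also have "\<dots> \<le> a * p + C1 * a * p"
        using consensus_error norm_y_avg[of i] mult_right_mono[OF r_le, of p] magnitude_ge_1[of c \<zeta>]
        by (intro add_mono) (auto intro: order_trans)
      finally have "norm (c i) * norm (y i - v i) \<le> p * (a * p + C1 * a * p)"
        using norm_le_magnitude[of c i \<zeta>] magnitude_ge_1[of c \<zeta>] by (intro mult_mono) auto
      then show ?thesis
        using norm_cauchy_schwarz[of "c i" "y i - v i"] by (simp add: power2_eq_square algebra_simps)
    qed
    ultimately show ?thesis by (simp add: inner_diff_right)
  qed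
  then have "(\<Sum>i\<in>UNIV. c i \<bullet> (y i - xs) + chi i (v i) - chi i xs)
      \<le> (\<Sum>i\<in>UNIV. 1 / a * (D xs (y i) - D xs (v i)) + (1 + C1) * a * p\<^sup>2)"
    by (rule sum_mono)
  also have "\<dots> = 1 / a * ((\<Sum>i\<in>UNIV. D xs (y i)) - (\<Sum>i\<in>UNIV. D xs (v i))) + real CARD('v) * (1 + C1) * a * p\<^sup>2"
    by (simp only: sum.distrib sum_subtractf flip: sum_distrib_left) simp
  also have "\<dots> \<le> 1 / a * ((\<Sum>i\<in>UNIV. D xs (u i)) + real CARD('v) * (L * (2 * R + 1)) * r * p\<^sup>2
      - (\<Sum>i\<in>UNIV. D xs (v i))) + real CARD('v) * (1 + C1) * a * p\<^sup>2"
    using a(1) bregman_y_sum by (intro add_right_mono mult_left_mono) auto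
  also have "\<dots> = 1 / a * ((\<Sum>i\<in>UNIV. D xs (u i)) - (\<Sum>i\<in>UNIV. D xs (v i)))
      + real CARD('v) * (1 + C1) * a * p\<^sup>2 + real CARD('v) * (L * (2 * R + 1)) * p\<^sup>2 * (r / a)"
    by (simp add: algebra_simps add_divide_distrib diff_divide_distrib)
  also have "\<dots> \<le> 1 / a * ((\<Sum>i\<in>UNIV. D xs (u i)) - (\<Sum>i\<in>UNIV. D xs (v i)))
      + real CARD('v) * (1 + C1) * a * p\<^sup>2 + real CARD('v) * (L * (2 * R + 1)) * p\<^sup>2 * a"
    using a(1) r(2) R0 L_nonneg
    by (intro add_left_mono mult_left_mono mult_nonneg_nonneg) (auto simp: field_simps power2_eq_square)
  finally show ?thesis
    by (simp add: C2_def algebra_simps)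
qed

text \<open>A round speaks of \<open>f i\<close> at \<open>y i\<close> and of \<open>chi i\<close>
  at \<open>v i\<close>, whereas the objective needs all functions at one agent's point
  \<open>u k\<close>. Both points are near \<open>avg i\<close>, which the disagreement puts near
  \<open>u k\<close>; the two transfers give the factor 2. The last sum is centred once
  \<open>s i\<close> is the conditional mean of \<open>c i\<close>.\<close>

lemma objective_descent:
  assumes s: "\<And>i. s i \<in> subdifferential (f i) (y i)"
  shows "total_objective f chi (u k) - total_objective f chi xs
    \<le> 1 / a * ((\<Sum>i\<in>UNIV. D xs (u i)) - (\<Sum>i\<in>UNIV. D xs (v i))) + descent_const CARD('v) \<sigma> L K R * a * p\<^sup>2
      + 2 * real CARD('v) * K * (\<Sum>i\<in>UNIV. \<Sum>j\<in>UNIV. norm (u i - u j))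
      - (\<Sum>i\<in>UNIV. (c i - s i) \<bullet> (y i - xs))"
proof -
  define d where "d = (\<Sum>i\<in>UNIV. \<Sum>j\<in>UNIV. norm (u i - u j))"
  have near: "norm (u k - avg i) \<le> d" for i
  proof -
    have "u k - avg i = (\<Sum>j\<in>UNIV. A $ i $ j *\<^sub>R (u k - u j))"
      by (simp add: avg_def scaleR_diff_right sum_subtractf A_row flip: scaleR_left.sum)
    also have "norm \<dots> \<le> (\<Sum>j\<in>UNIV. norm (u k - u j))"
      by (intro sum_norm_le) (simp add: A_nonneg A_le_1 mult_left_le_one_le)
    also have "\<dots> \<le> d"
      unfolding d_def by (rule member_le_sum) (auto intro: sum_nonneg)
    finally show ?thesis .
  qed
  have per_agent: "(f i (u k) + chi i (u k)) - (f i xs + chi i xs)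
      \<le> (c i \<bullet> (y i - xs) + chi i (v i) - chi i xs) - (c i - s i) \<bullet> (y i - xs)
        + (2 * K * d + K * (1 + C1) * a * p\<^sup>2)" for i
  proof -
    have ap: "r * p \<le> a * p\<^sup>2" "C1 * a * p \<le> C1 * a * p\<^sup>2"
      using r_le r(1) a p_le_square magnitude_ge_1[of c \<zeta>] C1_nonneg
      by (auto intro!: mult_mono mult_left_mono)
    have "norm (u k - y i) \<le> norm (u k - avg i) + norm (y i - avg i)" by norm
    also have "\<dots> \<le> d + a * p\<^sup>2"
      using near[of i] norm_y_avg[of i] ap by simp
    \<comment> \<open>Only \<open>u k\<close> is known to lie in \<open>X\<close>, which is all that
      the one-sided Lipschitz bound asks.\<close>
    finally have 1: "f i (u k) - f i (y i) \<le> K * (d + a * p\<^sup>2)"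
      using K(1)[OF u] K0 mult_left_mono order_trans by blast
    have "norm (u k - v i) \<le> norm (u k - avg i) + norm (v i - avg i)" by norm
    also have "\<dots> \<le> d + C1 * a * p\<^sup>2"
      using near[of i] consensus_error[of i] ap by simp
    finally have 2: "chi i (u k) - chi i (v i) \<le> K * (d + C1 * a * p\<^sup>2)"
      using K(2)[OF u] K0 mult_left_mono order_trans by blast
    have 3: "f i (y i) - f i xs \<le> s i \<bullet> (y i - xs)"
      using s[of i] by (auto simp: subdifferential_def inner_diff_right algebra_simps dest!: spec[of _ xs])
    show ?thesis
      using 1 2 3 by (simp add: inner_diff_left algebra_simps)
  qed
  have "total_objective f chi (u k) - total_objective f chi xs
      \<le> (\<Sum>i\<in>UNIV. (c i \<bullet> (y i - xs) + chi i (v i) - chi i xs) - (c i - s i) \<bullet> (y i - xs)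
        + (2 * K * d + K * (1 + C1) * a * p\<^sup>2))"
    unfolding total_objective_def sum_subtractf[symmetric] by (intro sum_mono per_agent)
  also have "\<dots> = (\<Sum>i\<in>UNIV. c i \<bullet> (y i - xs) + chi i (v i) - chi i xs) - (\<Sum>i\<in>UNIV. (c i - s i) \<bullet> (y i - xs))
      + real CARD('v) * (2 * K * d + K * (1 + C1) * a * p\<^sup>2)"
    by (simp add: sum.distrib sum_subtractf distrib_left)
  also have "\<dots> \<le> 1 / a * ((\<Sum>i\<in>UNIV. D xs (u i)) - (\<Sum>i\<in>UNIV. D xs (v i))) + C2 * a * p\<^sup>2
      - (\<Sum>i\<in>UNIV. (c i - s i) \<bullet> (y i - xs)) + real CARD('v) * (2 * K * d + K * (1 + C1) * a * p\<^sup>2)"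
    using descent_at_query by simp
  also have "\<dots> = 1 / a * ((\<Sum>i\<in>UNIV. D xs (u i)) - (\<Sum>i\<in>UNIV. D xs (v i))) + descent_const CARD('v) \<sigma> L K R * a * p\<^sup>2
      + 2 * real CARD('v) * K * d - (\<Sum>i\<in>UNIV. (c i - s i) \<bullet> (y i - xs))"
    by (simp add: descent_const_def C2_def algebra_simps)
  finally show ?thesis by (simp add: d_def)
qed

end

section \<open>From averaged gaps to the four limits\<close>

lemma running_min_tendsto:
  fixes h :: "nat \<Rightarrow> real"
  assumes lower: "\<And>t. 1 \<le> t \<Longrightarrow> c \<le> h t" and approx: "\<And>e. 0 < e \<Longrightarrow> \<exists>t\<ge>1. h t < c + e"
  shows "(\<lambda>T. MIN t\<in>{1..T}. h t) \<longlonglongrightarrow> c"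
proof (rule LIMSEQ_I)
  fix e :: real assume "0 < e"
  then obtain t where t: "1 \<le> t" "h t < c + e" using approx by blast
  have "norm ((MIN t\<in>{1..T}. h t) - c) < e" if T: "t \<le> T" for T
  proof -
    have "(MIN t\<in>{1..T}. h t) \<le> h t" using t T by (intro Min_le) auto
    moreover have "c \<le> (MIN t\<in>{1..T}. h t)"
      using t T lower by (subst Min_ge_iff) auto
    ultimately show ?thesis using t(2) by simp
  qed
  then show "\<exists>t0. \<forall>T\<ge>t0. norm ((MIN t\<in>{1..T}. h t) - c) < e" by blast
qed

text \<open>The lower bound is asked from index 1 on only: the average at \<open>T = 0\<close> is
  the zero vector, by the convention \<open>1 / 0 = 0\<close>, and may lie outside
  \<open>X\<close>.\<close>

lemma liminf_eq_of_subseq: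
  fixes h :: "nat \<Rightarrow> real"
  assumes "strict_mono \<phi>" "(\<lambda>n. h (\<phi> n)) \<longlonglongrightarrow> c" "\<And>T. 1 \<le> T \<Longrightarrow> c \<le> h T"
  shows "liminf (\<lambda>T. ereal (h T)) = ereal c"
proof (rule antisym)
  have "liminf (\<lambda>T. ereal (h T)) \<le> liminf ((\<lambda>T. ereal (h T)) \<circ> \<phi>)"
    using assms(1) by (rule liminf_subseq_mono)
  also have "\<dots> = ereal c"
    using assms(2) by (intro lim_imp_Liminf) (auto simp: o_def)
  finally show "liminf (\<lambda>T. ereal (h T)) \<le> ereal c" .
  show "ereal c \<le> liminf (\<lambda>T. ereal (h T))"
    using assms(3) by (intro Liminf_bounded) (auto intro!: eventually_sequentiallyI[of 1])
qed

text \<open>The points of \<open>X\<close> at distance at least \<open>e\<close> from the minimizers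
  form a compact set. Its least value exceeds the minimum over \<open>X\<close>, and the difference
  serves as \<delta>.\<close>

lemma near_minimizers:
  fixes H :: "real ^ 'n \<Rightarrow> real"
  assumes X: "compact X" and H: "continuous_on X H" and xs: "xs \<in> minimizers H X" and e: "0 < e"
  shows "\<exists>\<delta>>0. \<forall>z\<in>X. H z < H xs + \<delta> \<longrightarrow> infdist z (minimizers H X) < e"
proof -
  define S where "S = minimizers H X"
  define Y where "Y = X \<inter> {z. e \<le> infdist z S}"
  have "compact Y"
    unfolding Y_def
    by (intro compact_Int_closed X closed_Collect_le continuous_intros)
  show ?thesis
  proof (cases "Y = {}")
    case True
    then show ?thesis by (intro exI[of _ 1]) (auto simp: Y_def S_def not_le)
  next
    case False
    have "continuous_on Y H" using H by (rule continuous_on_subset) (auto simp: Y_def)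
    then obtain w where w: "w \<in> Y" "\<And>z. z \<in> Y \<Longrightarrow> H w \<le> H z"
      using continuous_attains_inf[OF \<open>compact Y\<close> False] by blast
    have "w \<notin> S"
      using w(1) e by (auto simp: Y_def)
    then have "H xs < H w"
      using xs w(1) unfolding S_def Y_def by (fastforce simp: minimizers_def is_arg_min_def)
    then show ?thesis
      using w(2) by (intro exI[of _ "H w - H xs"]) (fastforce simp: Y_def S_def not_le)
  qed
qed

text \<open>Jensen's inequality passes the averaged gap to the averaged iterate. For the running
  minima, an average below \<open>e\<close> forces a single gap below \<open>e\<close>, and that one
  index bounds all later minima; this is why they converge along the full sequence.\<close>

lemma averaged_gap_conclusion:
  fixes H :: "real ^ 'n \<Rightarrow> real" and z :: "nat \<Rightarrow> real ^ 'n"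
  assumes X: "compact X" "convex X" and H: "convex_on UNIV H" and xs: "xs \<in> minimizers H X"
    and z: "\<And>t. z t \<in> X" and \<phi>: "strict_mono \<phi>"
    and gap: "(\<lambda>n. (\<Sum>t=1..\<phi> n. H (z t) - H xs) / real (\<phi> n)) \<longlonglongrightarrow> 0"
  shows "liminf (\<lambda>T. ereal (H ((1 / real T) *\<^sub>R (\<Sum>t=1..T. z t)))) = ereal (H xs)"
    and "liminf (\<lambda>T. ereal (infdist ((1 / real T) *\<^sub>R (\<Sum>t=1..T. z t)) (minimizers H X))) = 0"
    and "(\<lambda>T. MIN t\<in>{1..T}. H (z t)) \<longlonglongrightarrow> H xs"
    and "(\<lambda>T. MIN t\<in>{1..T}. infdist (z t) (minimizers H X)) \<longlonglongrightarrow> 0"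
proof -
  define m where "m T = (1 / real T) *\<^sub>R (\<Sum>t=1..T. z t)" for T
  have cont: "continuous_on X H"
    using convex_on_continuous[OF open_UNIV H] continuous_on_subset by blast
  have min: "H xs \<le> H w" if "w \<in> X" for w
    using xs that by (auto simp: minimizers_def is_arg_min_def not_less)
  have m: "m T \<in> X \<and> H (m T) \<le> H xs + (\<Sum>t=1..T. H (z t) - H xs) / real T" if "1 \<le> T" for T
  proof -
    have eq: "m T = (\<Sum>t=1..T. (1 / real T) *\<^sub>R z t)"
      by (simp add: m_def scaleR_sum_right)
    have "m T \<in> X"
      unfolding eq using X(2) z that by (intro convex_sum) auto
    moreover have "H (m T) \<le> (\<Sum>t=1..T. (1 / real T) * H (z t))"
      unfolding eq using that by (intro convex_on_sum[OF _ _ H]) auto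
    moreover have "(\<Sum>t=1..T. (1 / real T) * H (z t)) = H xs + (\<Sum>t=1..T. H (z t) - H xs) / real T"
      using that by (simp add: sum_subtractf diff_divide_distrib sum_divide_distrib)
    ultimately show ?thesis by simp
  qed
  have \<phi>1: "\<forall>\<^sub>F n in sequentially. 1 \<le> \<phi> n"
    using seq_suble[OF \<phi>] by (intro eventually_sequentiallyI[of 1]) (use order_trans in blast)
  have Hm: "(\<lambda>n. H (m (\<phi> n))) \<longlonglongrightarrow> H xs"
  proof (rule tendsto_sandwich)
    show "\<forall>\<^sub>F n in sequentially. H xs \<le> H (m (\<phi> n))"
      using \<phi>1 by eventually_elim (use m min in blast)
    show "\<forall>\<^sub>F n in sequentially. H (m (\<phi> n)) \<le> H xs + (\<Sum>t=1..\<phi> n. H (z t) - H xs) / real (\<phi> n)"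
      using \<phi>1 by eventually_elim (use m in blast)
    show "(\<lambda>n. H xs + (\<Sum>t=1..\<phi> n. H (z t) - H xs) / real (\<phi> n)) \<longlonglongrightarrow> H xs"
      using tendsto_add[OF tendsto_const gap, of "H xs"] by simp
  qed simp
  have dm: "(\<lambda>n. infdist (m (\<phi> n)) (minimizers H X)) \<longlonglongrightarrow> 0"
  proof (rule order_tendstoI)
    fix e :: real assume "0 < e"
    from near_minimizers[OF X(1) cont xs this] obtain \<delta> where \<delta>: "0 < \<delta>"
      "\<And>w. w \<in> X \<Longrightarrow> H w < H xs + \<delta> \<Longrightarrow> infdist w (minimizers H X) < e" by blast
    have "\<forall>\<^sub>F n in sequentially. H (m (\<phi> n)) < H xs + \<delta>"
      using Hm \<delta>(1) by (intro order_tendstoD(2)[OF Hm]) simp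
    with \<phi>1 show "\<forall>\<^sub>F n in sequentially. infdist (m (\<phi> n)) (minimizers H X) < e"
      by eventually_elim (use m \<delta>(2) in blast)
  next
    fix e :: real assume "e < 0"
    then show "\<forall>\<^sub>F n in sequentially. e < infdist (m (\<phi> n)) (minimizers H X)"
      by (intro always_eventually allI order.strict_trans2[OF _ infdist_nonneg])
  qed
  have best: "\<exists>t\<ge>1. H (z t) < H xs + e" if e: "0 < e" for e
  proof -
    have "\<forall>\<^sub>F n in sequentially. (\<Sum>t=1..\<phi> n. H (z t) - H xs) / real (\<phi> n) < e"
      using order_tendstoD(2)[OF gap e] .
    with \<phi>1 have "\<forall>\<^sub>F n in sequentially. 1 \<le> \<phi> n \<and> (\<Sum>t=1..\<phi> n. H (z t) - H xs) / real (\<phi> n) < e"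
      by eventually_elim simp
    then obtain T where T: "1 \<le> T" "(\<Sum>t=1..T. H (z t) - H xs) / real T < e"
      by (auto simp: eventually_sequentially)
    then have "(\<Sum>t=1..T. H (z t) - H xs) < (\<Sum>t=1..T. e)"
      by (simp add: field_simps)
    then obtain t where "t \<in> {1..T}" "H (z t) - H xs < e"
      by (meson not_le sum_mono)
    then show ?thesis by (intro exI[of _ t]) auto
  qed
  show "liminf (\<lambda>T. ereal (H ((1 / real T) *\<^sub>R (\<Sum>t=1..T. z t)))) = ereal (H xs)"
    unfolding m_def[symmetric] using \<phi> Hm m min by (intro liminf_eq_of_subseq[where \<phi>=\<phi>]) blast+
  show "liminf (\<lambda>T. ereal (infdist ((1 / real T) *\<^sub>R (\<Sum>t=1..T. z t)) (minimizers H X))) = 0"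
    unfolding m_def[symmetric] zero_ereal_def
    using \<phi> dm by (intro liminf_eq_of_subseq[where \<phi>=\<phi>]) (auto simp: infdist_nonneg)
  show "(\<lambda>T. MIN t\<in>{1..T}. H (z t)) \<longlonglongrightarrow> H xs"
    using min z best by (intro running_min_tendsto) auto
  show "(\<lambda>T. MIN t\<in>{1..T}. infdist (z t) (minimizers H X)) \<longlonglongrightarrow> 0"
  proof (rule running_min_tendsto)
    fix e :: real assume "0 < e"
    from near_minimizers[OF X(1) cont xs this] obtain \<delta> where \<delta>: "0 < \<delta>"
      "\<And>w. w \<in> X \<Longrightarrow> H w < H xs + \<delta> \<Longrightarrow> infdist w (minimizers H X) < e" by blast
    then show "\<exists>t\<ge>1. infdist (z t) (minimizers H X) < 0 + e"
      using best[OF \<delta>(1)] z by auto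
  qed (rule infdist_nonneg)
qed

section \<open>Expected optimality gap\<close>

lemma sum_power2_le_card:
  fixes h :: "'i \<Rightarrow> real"
  assumes "finite I"
  shows "(\<Sum>i\<in>I. h i)\<^sup>2 \<le> real (card I) * (\<Sum>i\<in>I. (h i)\<^sup>2)"
  using Cauchy_Schwarz_ineq_sum[of "\<lambda>_. 1" h I] by simp

lemma magnitude_power2_le:
  fixes c :: "'v::finite \<Rightarrow> 'a::real_normed_vector"
  shows "(magnitude c \<zeta>)\<^sup>2 \<le> 3 * (1 + real CARD('v) * (\<Sum>i\<in>UNIV. (norm (c i))\<^sup>2)
    + (real CARD('v))\<^sup>2 * (\<Sum>i\<in>UNIV. \<Sum>j\<in>UNIV. (norm (\<zeta> i j))\<^sup>2))"
proof -
  define p q where "p = (\<Sum>i\<in>UNIV. norm (c i))" and "q = (\<Sum>i\<in>UNIV. \<Sum>j\<in>UNIV. norm (\<zeta> i j))"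
  have p: "p\<^sup>2 \<le> real CARD('v) * (\<Sum>i\<in>UNIV. (norm (c i))\<^sup>2)"
    unfolding p_def by (rule sum_power2_le_card) simp
  have "q = (\<Sum>k\<in>UNIV. norm (\<zeta> (fst k) (snd k)))"
    unfolding q_def by (simp add: sum.cartesian_product case_prod_beta)
  then have "q\<^sup>2 \<le> real (card (UNIV :: ('v \<times> 'v) set)) * (\<Sum>k\<in>UNIV. (norm (\<zeta> (fst k) (snd k)))\<^sup>2)"
    using sum_power2_le_card[of UNIV "\<lambda>k. norm (\<zeta> (fst k) (snd k))"] by simp
  also have "\<dots> = (real CARD('v))\<^sup>2 * (\<Sum>i\<in>UNIV. \<Sum>j\<in>UNIV. (norm (\<zeta> i j))\<^sup>2)"
    by (simp add: sum.cartesian_product case_prod_beta power2_eq_square)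
  finally have q: "q\<^sup>2 \<le> (real CARD('v))\<^sup>2 * (\<Sum>i\<in>UNIV. \<Sum>j\<in>UNIV. (norm (\<zeta> i j))\<^sup>2)" .
  have "(1 + p + q)\<^sup>2 \<le> 3 * (1 + p\<^sup>2 + q\<^sup>2)"
    using sum_squares_bound[of 1 p] sum_squares_bound[of 1 q] sum_squares_bound[of p q]
    by (simp add: power2_eq_square algebra_simps)
  with p q show ?thesis
    by (simp add: magnitude_def flip: p_def q_def)
qed

text \<open>Nonnegative conditional expectation preserves the integral even when it is infinite, so
  the conditional bound yields integrability first and the bound on the expectation
  afterwards.\<close>

lemma (in prob_space) cond_second_moment_bound:
  assumes sub: "subalgebra M H" and Z[measurable]: "Z \<in> borel_measurable M" and C: "0 \<le> C"
    and bound: "AE \<omega> in M. cond_second_moment M H Z \<omega> \<le> ennreal C"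
  shows "integrable M (\<lambda>\<omega>. (norm (Z \<omega>))\<^sup>2)" and "expectation (\<lambda>\<omega>. (norm (Z \<omega>))\<^sup>2) \<le> C"
proof -
  interpret finite_measure_subalgebra M H
    using sub by unfold_locales
  have "(\<integral>\<^sup>+\<omega>. ennreal ((norm (Z \<omega>))\<^sup>2) \<partial>M) = (\<integral>\<^sup>+\<omega>. cond_second_moment M H Z \<omega> \<partial>M)"
    unfolding cond_second_moment_def
    using nn_cond_exp_intg[of "\<lambda>_. 1" "\<lambda>\<omega>. ennreal ((norm (Z \<omega>))\<^sup>2)"] by simp
  also have "\<dots> \<le> (\<integral>\<^sup>+\<omega>. ennreal C \<partial>M)"
    by (rule nn_integral_mono_AE[OF bound])
  also have "\<dots> = ennreal C"
    by (simp add: emeasure_space_1)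
  finally have le: "(\<integral>\<^sup>+\<omega>. ennreal ((norm (Z \<omega>))\<^sup>2) \<partial>M) \<le> ennreal C" .
  show "integrable M (\<lambda>\<omega>. (norm (Z \<omega>))\<^sup>2)"
    using le by (intro integrableI_nonneg) (auto simp: le_less_trans)
  show "expectation (\<lambda>\<omega>. (norm (Z \<omega>))\<^sup>2) \<le> C"
    using le C by (subst integral_eq_nn_integral) (auto intro: enn2real_leI)
qed

section \<open>Pathwise bounds along a run\<close>

locale dscmd_run = prob_space M + smooth_mirror_map Phi dPhi \<sigma> L
  for M :: "'w measure" and Phi :: "real ^ 'n \<Rightarrow> real" and dPhi \<sigma> L +
  fixes F :: "nat \<Rightarrow> 'w measure"
    and X :: "(real ^ 'n) set"
    and f chi :: "'v::finite \<Rightarrow> real ^ 'n \<Rightarrow> real"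
    and P :: "nat \<Rightarrow> real ^ 'v ^ 'v"
    and \<xi> :: "'v \<Rightarrow> 'v \<Rightarrow> nat \<Rightarrow> 'w \<Rightarrow> real ^ 'n"
    and g :: "'v \<Rightarrow> real ^ 'n \<Rightarrow> real ^ 'n"
    and gt :: "'v \<Rightarrow> nat \<Rightarrow> real ^ 'n \<Rightarrow> 'w \<Rightarrow> real ^ 'n"
    and x0 :: "'v \<Rightarrow> real ^ 'n" and x y :: "'v \<Rightarrow> nat \<Rightarrow> 'w \<Rightarrow> real ^ 'n"
    and xs :: "real ^ 'n"
    and \<alpha> r :: "nat \<Rightarrow> real" and B :: nat and \<theta> \<nu> G K R :: real
  assumes X: "X \<noteq> {}" "convex X" "compact X"
    and f: "\<And>i. convex_on UNIV (f i)" and chi: "\<And>i. convex_on UNIV (chi i)"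
    and xs: "xs \<in> minimizers (total_objective f chi) X"
    and \<alpha>: "\<And>t. \<alpha> t = 1 / sqrt (real t + 1)" and r: "\<And>t. r t = 1 / (real t + 1)"
    and dscmd: "dscmd_n M X chi Phi dPhi P \<alpha> r \<xi> gt x0 x y"
    and adapted: "adapted_processes M F X \<xi> gt x y"
    and network: "network_assumption P B \<theta>"
    and subgradients: "stochastic_subgradient_assumption M F X f \<xi> g gt y G"
    and noise: "noise_assumption M F \<xi> \<nu>"
    and jensen: "\<And>z (b :: 'v \<Rightarrow> real ^ 'n) w. (\<And>i. w i \<in> {0..1}) \<Longrightarrow> (\<Sum>i\<in>UNIV. w i) = 1 \<Longrightarrow>
        D z (\<Sum>i\<in>UNIV. w i *\<^sub>R b i) \<le> (\<Sum>i\<in>UNIV. w i * D z (b i))"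
    and R: "\<And>z. z \<in> X \<Longrightarrow> norm z \<le> R"
    and K0: "0 \<le> K"
    and K: "\<And>i b a. b \<in> X \<Longrightarrow> f i b - f i a \<le> K * norm (b - a)"
      "\<And>i b a. b \<in> X \<Longrightarrow> chi i b - chi i a \<le> K * norm (b - a)"
begin

abbreviation "obj \<equiv> total_objective f chi"

abbreviation "oracle i t \<omega> \<equiv> gt i t (y i t \<omega>) \<omega>"

definition mag :: "nat \<Rightarrow> 'w \<Rightarrow> real" where
  "mag t \<omega> = magnitude (\<lambda>i. oracle i t \<omega>) (\<lambda>i j. \<xi> i j t \<omega>)"

text \<open>Stands in for \<open>g i (y i t \<omega>)\<close>: as \<open>g\<close> is an arbitrary
  selection of subgradients, that expression carries no measurability, while a version of the
  conditional expectation does. The two agree almost surely.\<close>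

definition mean_oracle :: "'v \<Rightarrow> nat \<Rightarrow> 'w \<Rightarrow> real ^ 'n" where
  "mean_oracle i t = vec_cond_exp M (past_noise M F \<xi> t) (\<lambda>\<omega>. oracle i t \<omega>)"

definition fluctuation :: "nat \<Rightarrow> 'w \<Rightarrow> real" where
  "fluctuation t \<omega> = (\<Sum>i\<in>UNIV. (oracle i t \<omega> - mean_oracle i t \<omega>) \<bullet> (y i t \<omega> - xs))"

lemma xs_in: "xs \<in> X" and xs_min: "z \<in> X \<Longrightarrow> obj xs \<le> obj z"
  using xs by (auto simp: minimizers_def is_arg_min_def not_less)

lemma R_nonneg: "0 \<le> R"
  using R[OF xs_in] norm_ge_zero order_trans by blast

lemma \<alpha>_bounds: "0 < \<alpha> t" "\<alpha> t \<le> 1" and r_eq: "r t = (\<alpha> t)\<^sup>2"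
  by (auto simp: \<alpha> r power_divide)

lemma x_0: "\<omega> \<in> space M \<Longrightarrow> x i 0 \<omega> = x0 i"
  and y_eq: "\<omega> \<in> space M \<Longrightarrow> y i t \<omega> = (\<Sum>j\<in>UNIV. P t $ i $ j *\<^sub>R (x j t \<omega> + r t *\<^sub>R \<xi> i j t \<omega>))"
  and x_step: "\<omega> \<in> space M \<Longrightarrow> mirror_step X (chi i) (\<alpha> t) (oracle i t \<omega>) (y i t \<omega>) (x i (Suc t) \<omega>)"
  using dscmd unfolding dscmd_n_def mirror_step_def by blast+

lemma x_in: "\<omega> \<in> space M \<Longrightarrow> x i t \<omega> \<in> X"
  using dscmd x_0 mirror_step_in[OF x_step] by (cases t) (auto simp: dscmd_n_def)

lemma P_stochastic: "doubly_stochastic (P t)"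
  using network by (simp add: network_assumption_def)

lemma round:
  assumes "\<omega> \<in> space M"
  shows "mirror_round Phi dPhi \<sigma> L f chi (P t) X (\<lambda>i. x i t \<omega>) (\<lambda>i. x i (Suc t) \<omega>)
    (\<lambda>i. y i t \<omega>) (\<lambda>i. oracle i t \<omega>) (\<lambda>i j. \<xi> i j t \<omega>) (\<alpha> t) (r t) K R xs"
  by unfold_locales
    (use assms X R xs_in x_in chi K0 K P_stochastic \<alpha>_bounds y_eq x_step jensen in \<open>auto simp: r_eq\<close>)

abbreviation "C \<equiv> step_const \<sigma> L K"

lemma C_nonneg: "0 \<le> C"
  using K0 L_nonneg \<sigma>_pos by (simp add: step_const_def)

lemma mag_ge_1: "1 \<le> mag t \<omega>"
  unfolding mag_def by (rule magnitude_ge_1)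

lemma mag_le_square: "mag t \<omega> \<le> (mag t \<omega>)\<^sup>2"
  using mag_ge_1[of t \<omega>] self_le_power[of "mag t \<omega>" 2] by simp

text \<open>The magnitude is squared here so that consensus perturbations and descent errors are
  summed by the same \<open>budget\<close>.\<close>

lemma consensus:
  assumes "\<omega> \<in> space M"
  shows "perturbed_consensus P B \<theta> (\<lambda>i t. x i t \<omega>) R (\<lambda>t. C * \<alpha> t * (mag t \<omega>)\<^sup>2)"
proof
  fix i t
  interpret mirror_round Phi dPhi \<sigma> L f chi "P t" X "\<lambda>i. x i t \<omega>" "\<lambda>i. x i (Suc t) \<omega>"
    "\<lambda>i. y i t \<omega>" "\<lambda>i. oracle i t \<omega>" "\<lambda>i j. \<xi> i j t \<omega>" "\<alpha> t" "r t" K R xs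
    using assms by (rule round)
  show "norm (x i (Suc t) \<omega> - (\<Sum>j\<in>UNIV. P t $ i $ j *\<^sub>R x j t \<omega>)) \<le> C * \<alpha> t * (mag t \<omega>)\<^sup>2"
    using consensus_error[of i] mult_left_mono[OF mag_le_square, of "C * \<alpha> t" t \<omega>] C_nonneg \<alpha>_bounds(1)[of t]
    by (simp add: avg_def mag_def)
qed (use network R x_in[OF assms] in auto)

definition budget :: "nat \<Rightarrow> 'w \<Rightarrow> real" where
  "budget T \<omega> = (\<Sum>t<T. \<alpha> t * (mag t \<omega>)\<^sup>2)"

definition C_spread :: real where
  "C_spread = real B * real CARD('v) ^ 4 * (3 / \<theta>)"

definition C_energy :: real where
  "C_energy = 4 * real CARD('v) * R\<^sup>2 / \<theta>"

definition C_perturb :: real where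
  "C_perturb = 8 * R * real CARD('v) * C / \<theta>"

lemma sum_spread_le_budget:
  assumes \<omega>: "\<omega> \<in> space M" and \<epsilon>: "0 < \<epsilon>"
  shows "(\<Sum>t=1..T. \<Sum>i\<in>UNIV. \<Sum>j\<in>UNIV. norm (x i t \<omega> - x j t \<omega>))
    \<le> C_spread * (real (T + B + 1) * real CARD('v) * \<epsilon> + C_energy / \<epsilon>
        + (C_perturb / \<epsilon> + C) * budget (T + B + 1) \<omega>)"
proof -
  interpret cons: perturbed_consensus P B \<theta> "\<lambda>i t. x i t \<omega>" R "\<lambda>t. C * \<alpha> t * (mag t \<omega>)\<^sup>2"
    using \<omega> by (rule consensus)
  have e: "(\<Sum>t<T + B + 1. C * \<alpha> t * (mag t \<omega>)\<^sup>2) = C * budget (T + B + 1) \<omega>"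
    unfolding budget_def by (simp only: sum_distrib_left mult.assoc)
  have "(\<Sum>t=1..T. \<Sum>i\<in>UNIV. \<Sum>j\<in>UNIV. norm (x i t \<omega> - x j t \<omega>))
      \<le> C_spread * ((\<Sum>t<T + B + 1. cons.link_spread t) + C * budget (T + B + 1) \<omega>)"
    using cons.sum_spread_le[of T] unfolding cons.spread_def sum.distrib e C_spread_def .
  also have "\<dots> \<le> C_spread * ((real (T + B + 1) * real CARD('v) * \<epsilon>
      + 4 / (\<theta> * \<epsilon>) * (real CARD('v) * R\<^sup>2 + 2 * R * real CARD('v) * (C * budget (T + B + 1) \<omega>)))
      + C * budget (T + B + 1) \<omega>)"
    using cons.sum_link_spread_le[OF \<epsilon>, of "T + B + 1"] cons.\<theta> unfolding e
    by (intro mult_left_mono add_right_mono) (auto simp: C_spread_def)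
  also have "\<dots> = C_spread * (real (T + B + 1) * real CARD('v) * \<epsilon> + C_energy / \<epsilon>
        + (C_perturb / \<epsilon> + C) * budget (T + B + 1) \<omega>)"
    using \<epsilon> cons.\<theta> by (simp add: C_energy_def C_perturb_def field_simps)
  finally show ?thesis .
qed

lemma telescope_le:
  fixes V :: "nat \<Rightarrow> real"
  assumes V: "\<And>t. 0 \<le> V t" "\<And>t. V t \<le> W"
  shows "(\<Sum>t=1..T. 1 / \<alpha> t * (V t - V (Suc t))) \<le> W * sqrt (real T + 1)"
proof -
  \<comment> \<open>The induction needs the slack \<open>W - V (Suc T)\<close>: taken with the next,
    larger root, it combines exactly with the next summand into the new slack.\<close>
  have "(\<Sum>t=1..T. 1 / \<alpha> t * (V t - V (Suc t))) \<le> (W - V (Suc T)) * sqrt (real T + 1)"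
  proof (induction T)
    case 0
    then show ?case using V by simp
  next
    case (Suc T)
    have "(W - V (Suc T)) * sqrt (real T + 1) \<le> (W - V (Suc T)) * sqrt (real (Suc T) + 1)"
      using V by (intro mult_left_mono) auto
    moreover have "1 / \<alpha> (Suc T) * (V (Suc T) - V (Suc (Suc T)))
        = (V (Suc T) - V (Suc (Suc T))) * sqrt (real (Suc T) + 1)"
      by (simp add: \<alpha>)
    ultimately show ?case using Suc.IH by (simp add: algebra_simps)
  qed
  also have "\<dots> \<le> W * sqrt (real T + 1)"
    using V(1)[of "Suc T"] by (intro mult_right_mono) auto
  finally show ?thesis .
qed

definition C_gap :: real where
  "C_gap = 2 * real CARD('v) * K"

definition C_divergence :: real where
  "C_divergence = real CARD('v) * (L * (2 * R)\<^sup>2)"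

definition C_descent :: real where
  "C_descent = descent_const CARD('v) \<sigma> L K R"

lemma C_descent_nonneg: "0 \<le> C_descent"
  using C_nonneg K0 L_nonneg R_nonneg by (simp add: C_descent_def descent_const_def)

text \<open>Apart from the gaps themselves, only \<open>budget\<close> and
  \<open>fluctuation\<close> vary with the sample point, so taking expectations reduces to these
  two. The hypothesis on \<open>mean_oracle\<close> is the one that holds merely almost
  surely.\<close>

lemma sum_gap_le:
  assumes \<omega>: "\<omega> \<in> space M" and s: "\<And>i t. mean_oracle i t \<omega> \<in> subdifferential (f i) (y i t \<omega>)"
    and \<epsilon>: "0 < \<epsilon>"
  shows "(\<Sum>t=1..T. obj (x k t \<omega>) - obj xs)
    \<le> C_divergence * sqrt (real T + 1)
      + C_gap * C_spread * (real (T + B + 1) * real CARD('v) * \<epsilon> + C_energy / \<epsilon>)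
      + (C_descent + C_gap * C_spread * (C_perturb / \<epsilon> + C)) * budget (T + B + 1) \<omega>
      - (\<Sum>t=1..T. fluctuation t \<omega>)"
proof -
  define V where "V t = (\<Sum>i\<in>UNIV. D xs (x i t \<omega>))" for t
  have V: "0 \<le> V t" "V t \<le> C_divergence" for t
  proof -
    show "0 \<le> V t" unfolding V_def by (intro sum_nonneg bregman_nonneg)
    have "D xs (x i t \<omega>) \<le> L * (2 * R)\<^sup>2" for i
    proof -
      have "norm (xs - x i t \<omega>) \<le> 2 * R"
        using norm_triangle_ineq4[of xs "x i t \<omega>"] R[OF xs_in] R[OF x_in[OF \<omega>, of i t]] by simp
      then show ?thesis
        using bregman_le[of xs "x i t \<omega>"] L_nonneg by (meson mult_left_mono norm_ge_zero order_trans power_mono)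
    qed
    then show "V t \<le> C_divergence"
      unfolding V_def C_divergence_def using sum_bounded_above[of UNIV "\<lambda>i. D xs (x i t \<omega>)"] by simp
  qed
  have "obj (x k t \<omega>) - obj xs \<le> 1 / \<alpha> t * (V t - V (Suc t)) + C_descent * (\<alpha> t * (mag t \<omega>)\<^sup>2)
      + C_gap * (\<Sum>i\<in>UNIV. \<Sum>j\<in>UNIV. norm (x i t \<omega> - x j t \<omega>)) - fluctuation t \<omega>" for t
  proof -
    interpret mirror_round Phi dPhi \<sigma> L f chi "P t" X "\<lambda>i. x i t \<omega>" "\<lambda>i. x i (Suc t) \<omega>"
      "\<lambda>i. y i t \<omega>" "\<lambda>i. oracle i t \<omega>" "\<lambda>i j. \<xi> i j t \<omega>" "\<alpha> t" "r t" K R xs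
      using \<omega> by (rule round)
    show ?thesis
      using objective_descent[of "\<lambda>i. mean_oracle i t \<omega>", OF s]
      by (simp add: V_def mag_def C_gap_def C_descent_def fluctuation_def mult.assoc)
  qed
  then have "(\<Sum>t=1..T. obj (x k t \<omega>) - obj xs)
      \<le> (\<Sum>t=1..T. 1 / \<alpha> t * (V t - V (Suc t)) + C_descent * (\<alpha> t * (mag t \<omega>)\<^sup>2)
      + C_gap * (\<Sum>i\<in>UNIV. \<Sum>j\<in>UNIV. norm (x i t \<omega> - x j t \<omega>)) - fluctuation t \<omega>)"
    by (rule sum_mono)
  also have "\<dots> = (\<Sum>t=1..T. 1 / \<alpha> t * (V t - V (Suc t))) + C_descent * (\<Sum>t=1..T. \<alpha> t * (mag t \<omega>)\<^sup>2)
      + C_gap * (\<Sum>t=1..T. \<Sum>i\<in>UNIV. \<Sum>j\<in>UNIV. norm (x i t \<omega> - x j t \<omega>)) - (\<Sum>t=1..T. fluctuation t \<omega>)"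
    by (simp only: sum.distrib sum_subtractf flip: sum_distrib_left)
  also have "\<dots> \<le> C_divergence * sqrt (real T + 1) + C_descent * budget (T + B + 1) \<omega>
      + C_gap * (C_spread * (real (T + B + 1) * real CARD('v) * \<epsilon> + C_energy / \<epsilon>
        + (C_perturb / \<epsilon> + C) * budget (T + B + 1) \<omega>)) - (\<Sum>t=1..T. fluctuation t \<omega>)"
  proof (intro add_mono diff_mono mult_left_mono order_refl telescope_le V sum_spread_le_budget \<omega> \<epsilon> C_descent_nonneg)
    show "(\<Sum>t=1..T. \<alpha> t * (mag t \<omega>)\<^sup>2) \<le> budget (T + B + 1) \<omega>"
      unfolding budget_def using \<alpha>_bounds(1) by (intro sum_mono2) (auto simp: less_imp_le)
    show "0 \<le> C_gap" using K0 by (simp add: C_gap_def)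
  qed
  finally show ?thesis by (simp add: algebra_simps)
qed


section \<open>Measurability and moments\<close>

lemma subalgebra_F: "subalgebra M (F t)"
  and \<xi>_F: "\<xi> i j t \<in> borel_measurable (F t)"
  and oracle_F: "oracle i t \<in> borel_measurable (F t)"
  and x_F: "x i t \<in> borel_measurable (F t)"
  and y_F: "y i t \<in> borel_measurable (F t)"
  using adapted by (auto simp: adapted_processes_def)

lemma \<xi>_measurable[measurable]: "\<xi> i j t \<in> borel_measurable M"
  and oracle_measurable[measurable]: "oracle i t \<in> borel_measurable M"
  and x_measurable[measurable]: "x i t \<in> borel_measurable M"
  and y_measurable[measurable]: "y i t \<in> borel_measurable M"
  using \<xi>_F oracle_F x_F y_F measurable_from_subalg[OF subalgebra_F] by blast+

lemma subalgebra_past: "subalgebra M (past M F t)"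
  using subalgebra_F by (cases t) (auto simp: past_def subalgebra_def sets.sigma_sets_subset)

abbreviation "H t \<equiv> past_noise M F \<xi> t"

lemma
  shows subalgebra_past_noise: "subalgebra M (H t)"
    and past_subalgebra_past_noise: "subalgebra (H t) (past M F t)"
    and \<xi>_past_noise: "\<xi> i j t \<in> borel_measurable (H t)"
proof -
  define S where "S = sets (past M F t) \<union> (\<Union>i j. sets (vimage_algebra (space M) (\<xi> i j t) borel))"
  have S: "S \<subseteq> sets M"
    using subalgebra_past[of t] sets_image_in_sets[OF refl \<xi>_measurable]
    unfolding S_def subalgebra_def by auto
  then have "S \<subseteq> Pow (space M)" using sets.space_closed by blast
  then have H: "space (H t) = space M" "sets (H t) = sigma_sets (space M) S"
    by (simp_all add: past_noise_def S_def)
  show "subalgebra M (H t)"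
    unfolding subalgebra_def H using S by (auto dest: sets.sigma_sets_subset)
  show "subalgebra (H t) (past M F t)"
    using subalgebra_past[of t] unfolding subalgebra_def H by (auto simp: S_def)
  show "\<xi> i j t \<in> borel_measurable (H t)"
  proof (rule measurableI)
    fix A :: "(real ^ 'n) set" assume "A \<in> sets borel"
    then have "\<xi> i j t -` A \<inter> space M \<in> S"
      unfolding S_def by (auto intro: in_vimage_algebra)
    then show "\<xi> i j t -` A \<inter> space (H t) \<in> sets (H t)"
      unfolding H by auto
  qed simp
qed

text \<open>
  Adaptedness only gives measurability of \<open>x i t\<close> with respect to \<open>F t\<close>; predictability comes
  from the continuity of the mirror step in its data.
\<close>

lemma x_past: "x i t \<in> borel_measurable (past M F t)"
proof (cases t)
  case 0
  have "space (past M F 0) = space M"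
    using subalgebra_past by (simp add: subalgebra_def)
  then show ?thesis
    unfolding 0 using x_0[of _ i] by (subst measurable_cong[of _ _ "\<lambda>_. x0 i"]) auto
next
  case (Suc s)
  have "space (F s) = space M"
    using subalgebra_F by (simp add: subalgebra_def)
  then have "x i (Suc s) \<in> borel_measurable (F s)"
    by (intro mirror_step_measurable[OF X(3,1,2) chi \<alpha>_bounds(1) oracle_F y_F x_step]) auto
  then show ?thesis by (simp add: Suc past_def)
qed

text \<open>Needed to pull the query point out of the conditional expectation of the oracle answer;
  adaptedness would only place it in \<open>F t\<close>, where that answer itself lives.\<close>

lemma y_past_noise: "y i t \<in> borel_measurable (H t)"
proof -
  have [measurable]: "x j t \<in> borel_measurable (H t)" "\<xi> i j t \<in> borel_measurable (H t)" for i j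
    using measurable_from_subalg[OF past_subalgebra_past_noise x_past] \<xi>_past_noise by auto
  have sp: "space (H t) = space M"
    using subalgebra_past_noise by (simp add: subalgebra_def)
  have "(\<lambda>\<omega>. \<Sum>j\<in>UNIV. P t $ i $ j *\<^sub>R (x j t \<omega> + r t *\<^sub>R \<xi> i j t \<omega>)) \<in> borel_measurable (H t)"
    by measurable
  then show ?thesis
    by (subst measurable_cong[OF y_eq]) (auto simp: sp)
qed

text \<open>The bound of \<open>magnitude_power2_le\<close> with \<open>G\<^sup>2\<close> in place
  of each squared oracle answer and \<nu> in place of each squared noise.\<close>

definition Q :: real where
  "Q = 3 * (1 + real CARD('v) * (real CARD('v) * G\<^sup>2)
    + (real CARD('v))\<^sup>2 * (real CARD('v) * (real CARD('v) * \<nu>)))"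

lemma mag_measurable[measurable]: "mag t \<in> borel_measurable M"
  unfolding mag_def magnitude_def by measurable

lemma
  shows mag_integrable: "integrable M (\<lambda>\<omega>. (mag t \<omega>)\<^sup>2)"
    and mag_expectation: "expectation (\<lambda>\<omega>. (mag t \<omega>)\<^sup>2) \<le> Q"
proof -
  define W where "W \<omega> = 3 * (1 + real CARD('v) * (\<Sum>i\<in>UNIV. (norm (oracle i t \<omega>))\<^sup>2)
    + (real CARD('v))\<^sup>2 * (\<Sum>i\<in>UNIV. \<Sum>j\<in>UNIV. (norm (\<xi> i j t \<omega>))\<^sup>2))" for \<omega>
  have le: "(mag t \<omega>)\<^sup>2 \<le> W \<omega>" for \<omega>
    unfolding mag_def W_def by (rule magnitude_power2_le)
  have oracle_le: "AE \<omega> in M. cond_second_moment M (H t) (oracle i t) \<omega> \<le> ennreal (G\<^sup>2)" for i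
    using subgradients by (simp add: stochastic_subgradient_assumption_def)
  have noise_le: "0 \<le> \<nu>" "AE \<omega> in M. cond_second_moment M (past M F t) (\<xi> i j t) \<omega> \<le> ennreal \<nu>" for i j
    using noise by (simp_all add: noise_assumption_def)
  have o: "integrable M (\<lambda>\<omega>. (norm (oracle i t \<omega>))\<^sup>2)" "expectation (\<lambda>\<omega>. (norm (oracle i t \<omega>))\<^sup>2) \<le> G\<^sup>2" for i
    by (rule cond_second_moment_bound[OF subalgebra_past_noise oracle_measurable zero_le_power2 oracle_le])+
  have n: "integrable M (\<lambda>\<omega>. (norm (\<xi> i j t \<omega>))\<^sup>2)" "expectation (\<lambda>\<omega>. (norm (\<xi> i j t \<omega>))\<^sup>2) \<le> \<nu>" for i j
    by (rule cond_second_moment_bound[OF subalgebra_past \<xi>_measurable noise_le])+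
  have W: "integrable M W"
    unfolding W_def by (intro integrable_mult_right Bochner_Integration.integrable_add Bochner_Integration.integrable_sum integrable_const o n)
  show int: "integrable M (\<lambda>\<omega>. (mag t \<omega>)\<^sup>2)"
    by (rule Bochner_Integration.integrable_bound[OF W]) (use le in \<open>auto intro!: AE_I2 order_trans[OF _ abs_ge_self]\<close>)
  have "expectation (\<lambda>\<omega>. (mag t \<omega>)\<^sup>2) \<le> expectation W"
    by (rule integral_mono[OF int W le])
  also have "\<dots> = 3 * (1 + real CARD('v) * (\<Sum>i\<in>UNIV. expectation (\<lambda>\<omega>. (norm (oracle i t \<omega>))\<^sup>2))
    + (real CARD('v))\<^sup>2 * (\<Sum>i\<in>UNIV. \<Sum>j\<in>UNIV. expectation (\<lambda>\<omega>. (norm (\<xi> i j t \<omega>))\<^sup>2)))"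
    unfolding W_def by (simp add: o n prob_space)
  also have "\<dots> \<le> 3 * (1 + real CARD('v) * (\<Sum>i\<in>(UNIV::'v set). G\<^sup>2)
    + (real CARD('v))\<^sup>2 * (\<Sum>i\<in>(UNIV::'v set). \<Sum>j\<in>(UNIV::'v set). \<nu>))"
    by (intro mult_left_mono add_mono sum_mono o n order_refl) auto
  also have "\<dots> = Q" by (simp add: Q_def)
  finally show "expectation (\<lambda>\<omega>. (mag t \<omega>)\<^sup>2) \<le> Q" .
qed

lemma Q_nonneg: "0 \<le> Q"
  using noise by (simp add: Q_def noise_assumption_def)

text \<open>Query points are unbounded; measuring them by \<open>mag\<close> makes the product of
  query point and oracle answer integrable, being dominated by a multiple of \<open>mag\<close>
  squared.\<close>

lemma query_dist_le:
  assumes \<omega>: "\<omega> \<in> space M"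
  shows "norm (y i t \<omega> - xs) \<le> mag t \<omega> * (1 + 2 * R)"
proof -
  interpret mirror_round Phi dPhi \<sigma> L f chi "P t" X "\<lambda>i. x i t \<omega>" "\<lambda>i. x i (Suc t) \<omega>"
    "\<lambda>i. y i t \<omega>" "\<lambda>i. oracle i t \<omega>" "\<lambda>i j. \<xi> i j t \<omega>" "\<alpha> t" "r t" K R xs
    using \<omega> by (rule round)
  have "norm (y i t \<omega> - xs) \<le> norm (y i t \<omega> - avg i) + norm (avg i) + norm xs"
    by norm
  moreover have "norm (y i t \<omega> - avg i) \<le> mag t \<omega>"
    using norm_y_avg[of i] r_le \<alpha>_bounds(2)[of t] mag_ge_1[of t \<omega>]
    by (simp add: mag_def) (meson mult_left_le_one_le order_trans r(1) zero_le_one)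
  moreover have "norm (avg i) \<le> R * mag t \<omega>" "norm xs \<le> R * mag t \<omega>"
    using R[OF avg_in[of i]] R[OF xs_in] mult_left_mono[OF mag_ge_1 R_nonneg, of t \<omega>] by auto
  ultimately show ?thesis by (simp add: algebra_simps)
qed

text \<open>In each coordinate \<open>y i t - xs\<close> is measurable for \<open>H t\<close>, so
  the oracle answer and its conditional expectation have the same integral against it. The argument
  runs by coordinates because conditional expectations of vectors are defined that way.\<close>

lemma
  shows fluctuation_integrable: "integrable M (fluctuation t)"
    and fluctuation_expectation: "expectation (fluctuation t) = 0"
proof -
  interpret finite_measure_subalgebra M "H t"
    using subalgebra_past_noise by unfold_locales
  have comp: "integrable M (\<lambda>\<omega>. (oracle i t \<omega> - mean_oracle i t \<omega>) $ k * (y i t \<omega> - xs) $ k)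
      \<and> expectation (\<lambda>\<omega>. (oracle i t \<omega> - mean_oracle i t \<omega>) $ k * (y i t \<omega> - xs) $ k) = 0" for i k
  proof -
    have yk: "(\<lambda>\<omega>. (y i t \<omega> - xs) $ k) \<in> borel_measurable (H t)"
      by (intro measurable_compose[OF y_past_noise] borel_measurable_continuous_onI continuous_intros)
    have ok: "(\<lambda>\<omega>. oracle i t \<omega> $ k) \<in> borel_measurable M"
      by (intro measurable_compose[OF oracle_measurable] borel_measurable_continuous_onI continuous_intros)
    have int: "integrable M (\<lambda>\<omega>. (y i t \<omega> - xs) $ k * oracle i t \<omega> $ k)"
    proof (rule Bochner_Integration.integrable_bound)
      show "integrable M (\<lambda>\<omega>. (1 + 2 * R) * (mag t \<omega>)\<^sup>2)"
        by (intro integrable_mult_right mag_integrable)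
      show "AE \<omega> in M. norm ((y i t \<omega> - xs) $ k * oracle i t \<omega> $ k) \<le> norm ((1 + 2 * R) * (mag t \<omega>)\<^sup>2)"
      proof (rule AE_I2)
        fix \<omega> assume \<omega>: "\<omega> \<in> space M"
        have "\<bar>(y i t \<omega> - xs) $ k\<bar> \<le> mag t \<omega> * (1 + 2 * R)" "\<bar>oracle i t \<omega> $ k\<bar> \<le> mag t \<omega>"
          using order_trans[OF component_le_norm_cart query_dist_le[OF \<omega>]]
            order_trans[OF component_le_norm_cart norm_le_magnitude[of "\<lambda>i. oracle i t \<omega>"]]
          unfolding mag_def by blast+
        then have "\<bar>(y i t \<omega> - xs) $ k\<bar> * \<bar>oracle i t \<omega> $ k\<bar> \<le> (mag t \<omega> * (1 + 2 * R)) * mag t \<omega>"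
          by (intro mult_mono) auto
        then show "norm ((y i t \<omega> - xs) $ k * oracle i t \<omega> $ k) \<le> norm ((1 + 2 * R) * (mag t \<omega>)\<^sup>2)"
          using R_nonneg by (simp add: abs_mult power2_eq_square mult_ac)
      qed
    qed (rule borel_measurable_times[OF measurable_from_subalg[OF subalgebra_past_noise yk] ok])
    note ce = real_cond_exp_intg[OF int yk ok]
    have "(\<lambda>\<omega>. (oracle i t \<omega> - mean_oracle i t \<omega>) $ k * (y i t \<omega> - xs) $ k)
        = (\<lambda>\<omega>. (y i t \<omega> - xs) $ k * oracle i t \<omega> $ k
          - (y i t \<omega> - xs) $ k * real_cond_exp M (H t) (\<lambda>\<omega>. oracle i t \<omega> $ k) \<omega>)"
      by (simp add: mean_oracle_def vec_cond_exp_def algebra_simps)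
    then show ?thesis
      using int ce by (simp add: Bochner_Integration.integral_diff)
  qed
  have eq: "fluctuation t = (\<lambda>\<omega>. \<Sum>i\<in>UNIV. \<Sum>k\<in>UNIV. (oracle i t \<omega> - mean_oracle i t \<omega>) $ k * (y i t \<omega> - xs) $ k)"
    by (simp add: fluctuation_def inner_vec_def fun_eq_iff)
  show "integrable M (fluctuation t)"
    unfolding eq using comp by (intro Bochner_Integration.integrable_sum) blast
  show "expectation (fluctuation t) = 0"
    unfolding eq using comp by (simp only: Bochner_Integration.integral_sum Bochner_Integration.integrable_sum) simp
qed

lemma mean_oracle_subgradient:
  "AE \<omega> in M. \<forall>i t. mean_oracle i t \<omega> \<in> subdifferential (f i) (y i t \<omega>)"
proof -
  have "AE \<omega> in M. mean_oracle i t \<omega> \<in> subdifferential (f i) (y i t \<omega>)" for i t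
  proof -
    have "AE \<omega> in M. g i (y i t \<omega>) \<in> subdifferential (f i) (y i t \<omega>)"
      "AE \<omega> in M. mean_oracle i t \<omega> = g i (y i t \<omega>)"
      using subgradients unfolding stochastic_subgradient_assumption_def mean_oracle_def by blast+
    then show ?thesis by eventually_elim simp
  qed
  then show ?thesis by (simp add: AE_all_countable)
qed

section \<open>Integrating the pathwise bounds\<close>

lemma obj_convex: "convex_on UNIV obj"
proof -
  have "convex_on UNIV (\<lambda>z. \<Sum>i\<in>I. f i z + chi i z)" if "finite I" for I
    using that
  proof induction
    case (insert i I)
    then show ?case by (simp add: convex_on_add f chi)
  qed (simp add: convex_on_def)
  then show ?thesis by (simp add: total_objective_def[abs_def])
qed

lemma gap_nonneg: "\<omega> \<in> space M \<Longrightarrow> 0 \<le> obj (x k t \<omega>) - obj xs"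
  using xs_min x_in by simp

lemma gap_integrable: "integrable M (\<lambda>\<omega>. obj (x k t \<omega>) - obj xs)"
proof -
  have cont: "continuous_on UNIV obj"
    using obj_convex by (simp add: convex_on_continuous)
  have [measurable]: "obj \<in> borel_measurable borel"
    using cont by (rule borel_measurable_continuous_onI)
  obtain b where "\<And>z. z \<in> X \<Longrightarrow> \<bar>obj z\<bar> \<le> b"
    using compact_imp_bounded[OF compact_continuous_image[OF continuous_on_subset[OF cont] X(3)]]
    unfolding bounded_iff by auto
  then show ?thesis
    by (intro Bochner_Integration.integrable_diff integrable_const integrable_const_bound[where B=b])
      (auto intro!: AE_I2 x_in)
qed

lemma sum_\<alpha>_le: "(\<Sum>t<n. \<alpha> t) \<le> 2 * sqrt (real n)"
proof (induction n)
  case (Suc n)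
  \<comment> \<open>The claim \<open>1 / sqrt (n + 1) \<le> 2 * (sqrt (n + 1) - sqrt n)\<close>,
    multiplied by \<open>sqrt (n + 1)\<close>, is this comparison of geometric and arithmetic
    mean.\<close>
  have "sqrt (real n) * sqrt (real n + 1) \<le> real n + 1 / 2"
    by (rule order_trans[OF arith_geo_mean_sqrt[unfolded real_sqrt_mult]]) auto
  then have "2 * sqrt (real n) + 1 / sqrt (real n + 1) \<le> 2 * sqrt (real n + 1)"
    by (simp add: field_simps)
  with Suc show ?case by (simp add: \<alpha> add.commute)
qed simp

lemma
  shows budget_integrable: "integrable M (budget n)"
    and budget_expectation: "expectation (budget n) \<le> 2 * Q * sqrt (real n)"
proof -
  have eq: "budget n = (\<lambda>\<omega>. \<Sum>t<n. \<alpha> t * (mag t \<omega>)\<^sup>2)"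
    by (simp add: budget_def fun_eq_iff)
  show "integrable M (budget n)"
    unfolding eq by (intro Bochner_Integration.integrable_sum integrable_mult_right mag_integrable)
  have "expectation (budget n) = (\<Sum>t<n. \<alpha> t * expectation (\<lambda>\<omega>. (mag t \<omega>)\<^sup>2))"
    unfolding eq by (simp add: mag_integrable)
  also have "\<dots> \<le> (\<Sum>t<n. \<alpha> t * Q)"
    using \<alpha>_bounds(1) by (intro sum_mono mult_left_mono mag_expectation) (simp add: less_imp_le)
  also have "\<dots> = (\<Sum>t<n. \<alpha> t) * Q" by (simp add: sum_distrib_right)
  also have "\<dots> \<le> (2 * sqrt (real n)) * Q"
    using sum_\<alpha>_le Q_nonneg by (rule mult_right_mono)
  finally show "expectation (budget n) \<le> 2 * Q * sqrt (real n)" by (simp add: mult_ac)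
qed

lemma expected_gap_le:
  assumes \<epsilon>: "0 < \<epsilon>"
  shows "expectation (\<lambda>\<omega>. \<Sum>t=1..T. obj (x k t \<omega>) - obj xs)
    \<le> C_divergence * sqrt (real T + 1)
      + C_gap * C_spread * (real (T + B + 1) * real CARD('v) * \<epsilon> + C_energy / \<epsilon>)
      + (C_descent + C_gap * C_spread * (C_perturb / \<epsilon> + C)) * (2 * Q * sqrt (real (T + B + 1)))"
proof -
  define a b where "a = C_divergence * sqrt (real T + 1)
      + C_gap * C_spread * (real (T + B + 1) * real CARD('v) * \<epsilon> + C_energy / \<epsilon>)"
    and "b = C_descent + C_gap * C_spread * (C_perturb / \<epsilon> + C)"
  have \<theta>: "0 < \<theta>" using network by (simp add: network_assumption_def)
  have b: "0 \<le> b"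
    unfolding b_def using C_descent_nonneg C_nonneg R_nonneg K0 \<epsilon> \<theta>
    by (simp add: C_gap_def C_spread_def C_perturb_def)
  have "expectation (\<lambda>\<omega>. \<Sum>t=1..T. obj (x k t \<omega>) - obj xs)
      \<le> expectation (\<lambda>\<omega>. a + b * budget (T + B + 1) \<omega> - (\<Sum>t=1..T. fluctuation t \<omega>))"
  proof (rule integral_mono_AE)
    show "integrable M (\<lambda>\<omega>. \<Sum>t=1..T. obj (x k t \<omega>) - obj xs)"
      by (intro Bochner_Integration.integrable_sum gap_integrable)
    show "integrable M (\<lambda>\<omega>. a + b * budget (T + B + 1) \<omega> - (\<Sum>t=1..T. fluctuation t \<omega>))"
      by (intro Bochner_Integration.integrable_diff Bochner_Integration.integrable_add Bochner_Integration.integrable_sum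
          integrable_mult_right integrable_const budget_integrable fluctuation_integrable)
    show "AE \<omega> in M. (\<Sum>t=1..T. obj (x k t \<omega>) - obj xs)
        \<le> a + b * budget (T + B + 1) \<omega> - (\<Sum>t=1..T. fluctuation t \<omega>)"
      using mean_oracle_subgradient AE_space
      by eventually_elim (use sum_gap_le \<epsilon> in \<open>simp add: a_def b_def\<close>)
  qed
  also have "\<dots> = a + b * expectation (budget (T + B + 1))"
    by (simp add: budget_integrable fluctuation_integrable fluctuation_expectation prob_space)
  also have "\<dots> \<le> a + b * (2 * Q * sqrt (real (T + B + 1)))"
    by (intro add_left_mono mult_left_mono budget_expectation b)
  finally show ?thesis by (simp add: a_def b_def)
qed

lemma average_gap_tendsto_0:
  "(\<lambda>T. expectation (\<lambda>\<omega>. norm ((\<Sum>t=1..T. obj (x k t \<omega>) - obj xs) / real T))) \<longlonglongrightarrow> 0"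
proof (rule tendsto_sandwich)
  define b where "b = real B"
  define c where "c = C_gap * C_spread"
  show "\<forall>\<^sub>F T in sequentially. 0 \<le> expectation (\<lambda>\<omega>. norm ((\<Sum>t=1..T. obj (x k t \<omega>) - obj xs) / real T))"
    by (intro always_eventually allI integral_nonneg_AE) auto
  show "\<forall>\<^sub>F T in sequentially. expectation (\<lambda>\<omega>. norm ((\<Sum>t=1..T. obj (x k t \<omega>) - obj xs) / real T))
    \<le> C_divergence * (sqrt (real T + 1) / real T)
      + c * real CARD('v) * ((real T + b + 1) * real T powr (-1/4) / real T)
      + c * C_energy * (real T powr (1/4) / real T)
      + (C_descent + c * C) * (2 * Q) * (sqrt (real T + b + 1) / real T)
      + c * C_perturb * (2 * Q) * (real T powr (1/4) * sqrt (real T + b + 1) / real T)"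
  proof (rule eventually_sequentiallyI[of 1])
    fix T :: nat assume T: "1 \<le> T"
    \<comment> \<open>Balances the cost \<epsilon> of the threshold against the perturbation term of
      order \<open>1 / (\<epsilon> * sqrt T)\<close>; with this choice both are of order
      \<open>T powr (-1/4)\<close>.\<close>
    define \<epsilon> where "\<epsilon> = real T powr (-1/4)"
    have \<epsilon>: "0 < \<epsilon>" "1 / \<epsilon> = real T powr (1/4)"
      using T by (auto simp: \<epsilon>_def powr_minus_divide)
    \<comment> \<open>The gaps are nonnegative, so the bound on their expectation is already a bound
      in L1.\<close>
    have "expectation (\<lambda>\<omega>. norm ((\<Sum>t=1..T. obj (x k t \<omega>) - obj xs) / real T))
        = expectation (\<lambda>\<omega>. (\<Sum>t=1..T. obj (x k t \<omega>) - obj xs) / real T)"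
      by (intro Bochner_Integration.integral_cong refl)
        (unfold real_norm_def, intro abs_of_nonneg divide_nonneg_nonneg sum_nonneg gap_nonneg, auto)
    also have "\<dots> = expectation (\<lambda>\<omega>. \<Sum>t=1..T. obj (x k t \<omega>) - obj xs) / real T"
      by simp
    also have "\<dots> \<le> (C_divergence * sqrt (real T + 1)
      + C_gap * C_spread * (real (T + B + 1) * real CARD('v) * \<epsilon> + C_energy / \<epsilon>)
      + (C_descent + C_gap * C_spread * (C_perturb / \<epsilon> + C)) * (2 * Q * sqrt (real (T + B + 1)))) / real T"
      by (intro divide_right_mono expected_gap_le \<epsilon>) auto
    also have "\<dots> = C_divergence * (sqrt (real T + 1) / real T)
      + c * real CARD('v) * ((real T + b + 1) * \<epsilon> / real T)
      + c * C_energy * ((1 / \<epsilon>) / real T)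
      + (C_descent + c * C) * (2 * Q) * (sqrt (real T + b + 1) / real T)
      + c * C_perturb * (2 * Q) * ((1 / \<epsilon>) * sqrt (real T + b + 1) / real T)"
    proof -
      have expand: "(d * u + c * (w * n * e + ce * k) + (cd + c * (cp * k + C)) * (2 * Q * s)) / T'
          = d * (u / T') + c * n * (w * e / T') + c * ce * (k / T') + (cd + c * C) * (2 * Q) * (s / T')
            + c * cp * (2 * Q) * (k * s / T')" for d u w n e ce k cd cp s T' :: real
        by (simp add: add_divide_distrib algebra_simps)
      have "real (T + B + 1) = real T + b + 1" by (simp add: b_def)
      then show ?thesis
        using expand[of C_divergence _ _ _ _ C_energy "1 / \<epsilon>"] by (simp only: c_def) simp
    qed
    finally show "expectation (\<lambda>\<omega>. norm ((\<Sum>t=1..T. obj (x k t \<omega>) - obj xs) / real T))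
      \<le> C_divergence * (sqrt (real T + 1) / real T)
      + c * real CARD('v) * ((real T + b + 1) * real T powr (-1/4) / real T)
      + c * C_energy * (real T powr (1/4) / real T)
      + (C_descent + c * C) * (2 * Q) * (sqrt (real T + b + 1) / real T)
      + c * C_perturb * (2 * Q) * (real T powr (1/4) * sqrt (real T + b + 1) / real T)"
      unfolding \<epsilon>(2) unfolding \<epsilon>_def .
  qed
  have "(\<lambda>T. sqrt (real T + 1) / real T) \<longlonglongrightarrow> 0"
    "(\<lambda>T. (real T + b + 1) * real T powr (-1/4) / real T) \<longlonglongrightarrow> 0"
    "(\<lambda>T. real T powr (1/4) / real T) \<longlonglongrightarrow> 0"
    "(\<lambda>T. sqrt (real T + b + 1) / real T) \<longlonglongrightarrow> 0"
    "(\<lambda>T. real T powr (1/4) * sqrt (real T + b + 1) / real T) \<longlonglongrightarrow> 0"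
    by real_asymp+
  then show "(\<lambda>T. C_divergence * (sqrt (real T + 1) / real T)
      + c * real CARD('v) * ((real T + b + 1) * real T powr (-1/4) / real T)
      + c * C_energy * (real T powr (1/4) / real T)
      + (C_descent + c * C) * (2 * Q) * (sqrt (real T + b + 1) / real T)
      + c * C_perturb * (2 * Q) * (real T powr (1/4) * sqrt (real T + b + 1) / real T)) \<longlonglongrightarrow> 0"
    by (intro tendsto_add_zero tendsto_mult_right_zero)
qed simp

text \<open>The subsequence found does not depend on the sample point, but it may depend on the
  agent \<open>k\<close>. Claiming existence pointwise lets all agents be gathered on one event of
  full measure.\<close>

lemma AE_average_gap_subseq:
  "AE \<omega> in M. \<exists>\<phi>. strict_mono \<phi> \<and>
    (\<lambda>n. (\<Sum>t=1..\<phi> n. obj (x k t \<omega>) - obj xs) / real (\<phi> n)) \<longlonglongrightarrow> 0"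
proof -
  have "integrable M (\<lambda>\<omega>. (\<Sum>t=1..T. obj (x k t \<omega>) - obj xs) / real T)" for T
    by (intro integrable_divide Bochner_Integration.integrable_sum gap_integrable)
  from tendsto_L1_AE_subseq[OF this average_gap_tendsto_0] obtain \<phi> where
    "strict_mono \<phi>" "AE \<omega> in M. (\<lambda>n. (\<Sum>t=1..\<phi> n. obj (x k t \<omega>) - obj xs) / real (\<phi> n)) \<longlonglongrightarrow> 0"
    by blast
  then show ?thesis by (auto elim!: eventually_mono)
qed

lemma AE_conclusion:
  "AE \<omega> in M. \<forall>i.
      liminf (\<lambda>T. ereal (obj (average_iterate x i T \<omega>))) = ereal (obj xs) \<and>
      liminf (\<lambda>T. ereal (infdist (average_iterate x i T \<omega>) (minimizers obj X))) = 0 \<and>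
      (\<lambda>T. MIN t\<in>{1..T}. obj (x i t \<omega>)) \<longlonglongrightarrow> obj xs \<and>
      (\<lambda>T. MIN t\<in>{1..T}. infdist (x i t \<omega>) (minimizers obj X)) \<longlonglongrightarrow> 0"
proof -
  have "AE \<omega> in M. \<forall>k. \<exists>\<phi>. strict_mono \<phi> \<and>
      (\<lambda>n. (\<Sum>t=1..\<phi> n. obj (x k t \<omega>) - obj xs) / real (\<phi> n)) \<longlonglongrightarrow> 0"
    using AE_average_gap_subseq by (simp add: AE_all_countable)
  then show ?thesis
    using AE_space
  proof eventually_elim
    case (elim \<omega>)
    show ?case
    proof
      fix i
      obtain \<phi> where \<phi>: "strict_mono \<phi>"
        "(\<lambda>n. (\<Sum>t=1..\<phi> n. obj (x i t \<omega>) - obj xs) / real (\<phi> n)) \<longlonglongrightarrow> 0"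
        using elim(1) by blast
      show "liminf (\<lambda>T. ereal (obj (average_iterate x i T \<omega>))) = ereal (obj xs) \<and>
          liminf (\<lambda>T. ereal (infdist (average_iterate x i T \<omega>) (minimizers obj X))) = 0 \<and>
          (\<lambda>T. MIN t\<in>{1..T}. obj (x i t \<omega>)) \<longlonglongrightarrow> obj xs \<and>
          (\<lambda>T. MIN t\<in>{1..T}. infdist (x i t \<omega>) (minimizers obj X)) \<longlonglongrightarrow> 0"
        unfolding average_iterate_def
        using averaged_gap_conclusion[OF X(3,2) obj_convex xs x_in[OF elim(2)] \<phi>] by blast
    qed
  qed
qed

end

section \<open>Extracting the constants of a run from the assumptions\<close>

theorem corollary4:
  fixes M :: "'w measure" and F :: "nat \<Rightarrow> 'w measure"
    and X :: "(real ^ 'n) set"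
    and f chi :: "'v::finite \<Rightarrow> real ^ 'n \<Rightarrow> real"
    and Phi :: "real ^ 'n \<Rightarrow> real" and dPhi :: "real ^ 'n \<Rightarrow> real ^ 'n"
    and P :: "nat \<Rightarrow> real ^ 'v ^ 'v"
    and \<xi> :: "'v \<Rightarrow> 'v \<Rightarrow> nat \<Rightarrow> 'w \<Rightarrow> real ^ 'n"
    and g :: "'v \<Rightarrow> real ^ 'n \<Rightarrow> real ^ 'n"
    and gt :: "'v \<Rightarrow> nat \<Rightarrow> real ^ 'n \<Rightarrow> 'w \<Rightarrow> real ^ 'n"
    and x0 :: "'v \<Rightarrow> real ^ 'n" and x y :: "'v \<Rightarrow> nat \<Rightarrow> 'w \<Rightarrow> real ^ 'n"
    and xs :: "real ^ 'n"
    and \<alpha> r :: "nat \<Rightarrow> real" and B :: nat and \<theta> \<nu> G\<^sub>f \<sigma> L :: real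
  assumes "prob_space M"
    and "X \<noteq> {}" "convex X" "compact X"
    and "\<And>i. convex_on UNIV (f i)" "\<And>i. convex_on UNIV (chi i)"
    and "xs \<in> minimizers (total_objective f chi) X"
    and "mirror_map Phi dPhi \<sigma>"
    and "\<And>t. \<alpha> t = 1 / sqrt (real t + 1)" "\<And>t. r t = 1 / (real t + 1)"
    and "dscmd_n M X chi Phi dPhi P \<alpha> r \<xi> gt x0 x y"
    and "adapted_processes M F X \<xi> gt x y"
    and "network_assumption P B \<theta>"
    and "stochastic_subgradient_assumption M F X f \<xi> g gt y G\<^sub>f"
    and "noise_assumption M F \<xi> \<nu>"
    and "mirror_map_assumption TYPE('v) Phi dPhi L"
  shows "AE \<omega> in M. \<forall>i.
      liminf (\<lambda>T. ereal (total_objective f chi (average_iterate x i T \<omega>)))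
        = ereal (total_objective f chi xs) \<and>
      liminf (\<lambda>T. ereal (infdist (average_iterate x i T \<omega>) (minimizers (total_objective f chi) X)))
        = 0 \<and>
      (\<lambda>T. MIN t\<in>{1..T}. total_objective f chi (x i t \<omega>))
        \<longlonglongrightarrow> total_objective f chi xs \<and>
      (\<lambda>T. MIN t\<in>{1..T}. infdist (x i t \<omega>) (minimizers (total_objective f chi) X))
        \<longlonglongrightarrow> 0"
proof -
  have grad: "GDERIV Phi z :> dPhi z" for z
    using assms(8) by (simp add: mirror_map_def)
  have "continuous_on UNIV Phi"
    using grad by (intro continuous_at_imp_continuous_on) (auto simp: gderiv_def dest: has_derivative_continuous)
  moreover have lip: "norm (dPhi u - dPhi v) \<le> L * norm (u - v)" for u v
    using assms(16) by (simp add: mirror_map_assumption_def)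
  \<comment> \<open>The Lipschitz inequality between the origin and a unit vector forces the sign of
    \<open>L\<close>.\<close>
  moreover have "0 \<le> L"
    using order_trans[OF norm_ge_zero lip[of "axis undefined 1" 0]] by simp
  ultimately have mirror: "smooth_mirror_map Phi dPhi \<sigma> L"
    using assms(8) by unfold_locales (auto simp: mirror_map_def)
  have jensen: "bregman Phi dPhi z (\<Sum>i\<in>UNIV. w i *\<^sub>R b i) \<le> (\<Sum>i\<in>UNIV. w i * bregman Phi dPhi z (b i))"
    if "\<And>i. w i \<in> {0..1}" "(\<Sum>i\<in>UNIV. w i) = 1" for z and b :: "'v \<Rightarrow> real ^ 'n" and w :: "'v \<Rightarrow> real"
    using assms(16) that unfolding mirror_map_assumption_def by blast
  obtain R where R: "\<And>z. z \<in> X \<Longrightarrow> norm z \<le> R"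
    using compact_imp_bounded[OF assms(4)] by (auto simp: bounded_iff)
  obtain Kf where Kf: "\<And>i. 0 \<le> Kf i" "\<And>i b a. b \<in> X \<Longrightarrow> f i b - f i a \<le> Kf i * norm (b - a)"
    using convex_on_UNIV_lipschitz_on_compact[OF assms(5,4)] by metis
  obtain Kc where Kc: "\<And>i. 0 \<le> Kc i" "\<And>i b a. b \<in> X \<Longrightarrow> chi i b - chi i a \<le> Kc i * norm (b - a)"
    using convex_on_UNIV_lipschitz_on_compact[OF assms(6,4)] by metis
  \<comment> \<open>Summing the nonnegative constants of all agents gives one that dominates each of
    them, for \<open>f\<close> and \<open>chi\<close> alike.\<close>
  define K where "K = (\<Sum>i\<in>UNIV. Kf i + Kc i)"
  have "Kf i + Kc i \<le> K" for i
    unfolding K_def by (rule member_le_sum) (auto simp: Kf Kc)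
  then have "Kf i \<le> K" "Kc i \<le> K" for i
    using Kf(1)[of i] Kc(1)[of i] by (meson add_increasing add_increasing2 order_refl order_trans)+
  then have K: "b \<in> X \<Longrightarrow> f i b - f i a \<le> K * norm (b - a)"
    "b \<in> X \<Longrightarrow> chi i b - chi i a \<le> K * norm (b - a)" for i b a
    using Kf(2) Kc(2) by (meson mult_right_mono norm_ge_zero order_trans)+
  have "0 \<le> K"
    unfolding K_def using Kf(1) Kc(1) by (intro sum_nonneg) simp
  interpret prob_space M by (rule assms(1))
  interpret smooth_mirror_map Phi dPhi \<sigma> L by (rule mirror)
  interpret dscmd_run M Phi dPhi \<sigma> L F X f chi P \<xi> g gt x0 x y xs \<alpha> r B \<theta> \<nu> G\<^sub>f K R
    by unfold_locales (fact assms jensen R K \<open>0 \<le> K\<close>)+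
  show ?thesis by (rule AE_conclusion)
qed

end
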